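(* Let $\gamma$ be a smooth closed planar curve with strictly positive curvature bounding a convex region, and let $(M_i)_{i\ge 0}$ and $(N_i)_{i\ge 1}$ be the sequences of iterated involutes associated with $\gamma$, with symmetric curves $u$ and $v$ as in the context. Let $O=O(\gamma)$ be the central point of $\gamma$. Fix constants $c$ and $d$ for which the curves $\gamma_i=M_i+cu$ and $\eta_i=N_i+dv$ are convex. Then, as $i\to\infty$, the sequences of parameterized curves $\gamma_i$ and $\eta_i$ converge in the $C^\infty$ topology to $O+cu$ and $O+dv$, respectively.
   Context: $[w_1,w_2]$ denotes the determinant of the $2\times 2$ matrix with columns $w_1,w_2\in\mathbb{R}^2$, and $e_\theta=(-\sin\theta,\cos\theta)$. The curve $\gamma$ is parameterized by $\theta$ ($2\pi$-periodically) so that $\gamma'(\theta)$ is a positive multiple of $e_\theta$. Put $M(\theta)=\frac12(\gamma(\theta)+\gamma(\theta+\pi))$ (the area evolute of $\gamma$). Fix $k>0$ and put $u(\theta)=\frac{k}{2}(\gamma(\theta)-\gamma(\theta+\pi))$; $u$ is a smooth convex curve, symmetric about the origin ($u(\theta+\pi)=-u(\theta)$), with strictly positive curvature, and $u'(\theta)$ is a positive multiple of $e_\theta$. Put $v(\theta)=u'(\theta)/[u(\theta),u'(\theta)]$; $v$ is also a smooth convex origin-symmetric curve, $[u,v]=1$ and $u=-v'/[v,v']$. Iterated involutes: $M_0=M$, and $\alpha_0$ is the function with $M_0'=\alpha_0u'$. Inductively, for $i\ge 0$, $$\beta_{i+1}(\theta)=\tfrac12\int_\theta^{\theta+\pi}\alpha_i[u,u']\,ds,\qquad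 N_{i+1}=M_i+\beta_{i+1}v,$$ and for $i\ge 1$, $$\alpha_i(\theta)=-\tfrac12\int_\theta^{\theta+\pi}\beta_i[v,v']\,ds,\qquad M_i=N_i+\alpha_iu.$$ One has $M_i'=\alpha_iu'$ and $N_i'=\beta_iv'$. For a closed curve $K$ among the $M_i$, $N_i$, the region $\overline{K}$ bounded by $K$ is the complement of the exterior of $K$, where the exterior is the unbounded connected component of the complement of (the image of) $K$ in $\mathbb{R}^2$. The set $\bigcap_{i\ge 0}\overline{M_i}\cap\bigcap_{i\ge 1}\overline{N_i}$ consists of a single point, called the central point $O(\gamma)$ of $\gamma$. Convergence in the $C^\infty$ topology means uniform convergence in $\theta$ of the functions and of their derivatives of every order. *)

theory Defs
  imports "HOL-Analysis.Analysis"
begin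

definition bracket :: "real^2 \<Rightarrow> real^2 \<Rightarrow> real" where
  "bracket w1 w2 = det (transpose (vector [w1, w2]) :: real^2^2)"

definition edir :: "real \<Rightarrow> real^2" where
  "edir \<theta> = vector [- sin \<theta>, cos \<theta>]"

definition D :: "(real \<Rightarrow> real^2) \<Rightarrow> real \<Rightarrow> real^2" where
  "D f \<theta> = vector_derivative f (at \<theta>)"

definition smooth_curve :: "(real \<Rightarrow> real^2) \<Rightarrow> bool" where
  "smooth_curve f \<longleftrightarrow> (\<forall>n \<theta>. (D ^^ n) f differentiable (at \<theta>))"

definition curvature :: "(real \<Rightarrow> real^2) \<Rightarrow> real \<Rightarrow> real" where
  "curvature f \<theta> = bracket (D f \<theta>) (D (D f) \<theta>) / norm (D f \<theta>) ^ 3"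

text \<open>The exterior of a closed curve \<open>K\<close> is the unbounded component of the complement of its
  image. This is \<^const>\<open>outside\<close> applied to the image: the image is compact, so in the plane its
  complement has exactly one unbounded component. All curves are \<open>2\<pi>\<close>-periodic functions on
  the whole line, so the image of \<open>K\<close> is \<open>range K\<close>.\<close>

definition region :: "(real \<Rightarrow> real^2) \<Rightarrow> (real^2) set" where
  "region K = - outside (range K)"

text \<open>Injectivity of \<open>K\<close> on a period is not demanded: a convex curve may have a corner, at which
  its parameterization by tangent direction stays constant.\<close>

definition bounds_convex_region :: "(real \<Rightarrow> real^2) \<Rightarrow> bool" where
  "bounds_convex_region K \<longleftrightarrow> convex (region K) \<and> frontier (region K) = range K"

text \<open>Smoothness of the curves and of the limit is part of the definition because \<^const>\<open>D\<close> is
  meaningless where a curve is not differentiable.\<close>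

definition converges_Cinf :: "(nat \<Rightarrow> real \<Rightarrow> real^2) \<Rightarrow> (real \<Rightarrow> real^2) \<Rightarrow> bool" where
  "converges_Cinf f g \<longleftrightarrow> (\<forall>i. smooth_curve (f i)) \<and> smooth_curve g \<and>
     (\<forall>n. uniform_limit UNIV (\<lambda>i. (D ^^ n) (f i)) ((D ^^ n) g) sequentially)"

definition area_evolute :: "(real \<Rightarrow> real^2) \<Rightarrow> real \<Rightarrow> real^2" where
  "area_evolute \<gamma> \<theta> = (1/2) *\<^sub>R (\<gamma> \<theta> + \<gamma> (\<theta> + pi))"

definition ucurve :: "(real \<Rightarrow> real^2) \<Rightarrow> real \<Rightarrow> real \<Rightarrow> real^2" where
  "ucurve \<gamma> k \<theta> = (k/2) *\<^sub>R (\<gamma> \<theta> - \<gamma> (\<theta> + pi))"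

definition vcurve :: "(real \<Rightarrow> real^2) \<Rightarrow> real \<Rightarrow> real \<Rightarrow> real^2" where
  "vcurve \<gamma> k \<theta> = (1 / bracket (ucurve \<gamma> k \<theta>) (D (ucurve \<gamma> k) \<theta>)) *\<^sub>R D (ucurve \<gamma> k) \<theta>"

text \<open>The sequences \<open>\<beta>\<^sub>i\<close> and \<open>N\<^sub>i\<close> start at \<open>i = 1\<close>; their clauses at \<open>0\<close> are placeholders.\<close>

function alpha :: "(real \<Rightarrow> real^2) \<Rightarrow> real \<Rightarrow> nat \<Rightarrow> real \<Rightarrow> real"
  and beta :: "(real \<Rightarrow> real^2) \<Rightarrow> real \<Rightarrow> nat \<Rightarrow> real \<Rightarrow> real" where
  "alpha \<gamma> k 0 = (THE a. \<forall>\<theta>. D (area_evolute \<gamma>) \<theta> = a \<theta> *\<^sub>R D (ucurve \<gamma> k) \<theta>)"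
| "alpha \<gamma> k (Suc i) = (\<lambda>\<theta>. - (1/2) * integral {\<theta>..\<theta> + pi}
     (\<lambda>s. beta \<gamma> k (Suc i) s * bracket (vcurve \<gamma> k s) (D (vcurve \<gamma> k) s)))"
| "beta \<gamma> k 0 = undefined"
| "beta \<gamma> k (Suc i) = (\<lambda>\<theta>. (1/2) * integral {\<theta>..\<theta> + pi}
     (\<lambda>s. alpha \<gamma> k i s * bracket (ucurve \<gamma> k s) (D (ucurve \<gamma> k) s)))"
  by pat_completeness auto
termination
  by (relation "Wellfounded.measure
    (case_sum (\<lambda>(\<gamma>, k, i). 2 * i + 1) (\<lambda>(\<gamma>, k, i). 2 * i))") auto

function Mcurve :: "(real \<Rightarrow> real^2) \<Rightarrow> real \<Rightarrow> nat \<Rightarrow> real \<Rightarrow> real^2"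
  and Ncurve :: "(real \<Rightarrow> real^2) \<Rightarrow> real \<Rightarrow> nat \<Rightarrow> real \<Rightarrow> real^2" where
  "Mcurve \<gamma> k 0 = area_evolute \<gamma>"
| "Mcurve \<gamma> k (Suc i) = (\<lambda>\<theta>. Ncurve \<gamma> k (Suc i) \<theta> + alpha \<gamma> k (Suc i) \<theta> *\<^sub>R ucurve \<gamma> k \<theta>)"
| "Ncurve \<gamma> k 0 = undefined"
| "Ncurve \<gamma> k (Suc i) = (\<lambda>\<theta>. Mcurve \<gamma> k i \<theta> + beta \<gamma> k (Suc i) \<theta> *\<^sub>R vcurve \<gamma> k \<theta>)"
  by pat_completeness auto
termination
  by (relation "Wellfounded.measure
    (case_sum (\<lambda>(\<gamma>, k, i). 2 * i + 1) (\<lambda>(\<gamma>, k, i). 2 * i))") auto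

text \<open>The parameter \<open>k\<close> only fixes the scale of \<open>u\<close> and \<open>v\<close>; the curves \<open>M\<^sub>i\<close> and \<open>N\<^sub>i\<close>, and
  hence the central point, do not depend on the choice of \<open>k > 0\<close>.\<close>

definition central_point :: "(real \<Rightarrow> real^2) \<Rightarrow> real \<Rightarrow> real^2" where
  "central_point \<gamma> k =
     the_elem ((\<Inter>i. region (Mcurve \<gamma> k i)) \<inter> (\<Inter>i\<in>{1..}. region (Ncurve \<gamma> k i)))"

end

theory Submission
  imports Defs "HOL-Complex_Analysis.Riemann_Mapping"
begin

text \<open>
  Write \<open>w = [u, u']\<close> and \<open>q = [v, v']\<close>, so that \<open>u' = w v\<close> and \<open>v' = - q u\<close>. Let \<open>O\<close> be the point with
  \<open>\<integral> [O - M, v] w v = 0\<close>, and expand \<open>O - M\<^sub>i = X\<^sub>i u + Y\<^sub>i v\<close>. Then \<open>O - N\<^sub>i\<^sub>+\<^sub>1 = X\<^sub>i u + Y\<^sub>i\<^sub>+\<^sub>1 v\<close>,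
  \<open>X\<^sub>i' = q Y\<^sub>i\<close>, \<open>Y\<^sub>i\<^sub>+\<^sub>1' = - w X\<^sub>i\<close>, and the orthogonality \<open>\<integral> X\<^sub>i w v = 0\<close> persists.
  Since \<open>\<integral> w X\<^sub>i X\<^sub>i\<^sub>+\<^sub>1 = \<integral> q Y\<^sub>i\<^sub>+\<^sub>1\<^sup>2\<close>, a Wirtinger inequality makes the numbers \<open>\<integral> w X\<^sub>i\<^sup>2\<close>,
  \<open>\<integral> w X\<^sub>i X\<^sub>i\<^sub>+\<^sub>1\<close>, \<open>\<integral> w X\<^sub>i\<^sub>+\<^sub>1\<^sup>2\<close>, \<open>\<dots>\<close> decrease. Hence \<open>X\<^sub>i\<^sub>+\<^sub>1 - X\<^sub>i\<close> tends to \<open>0\<close> in mean square, so \<open>O - M\<^sub>i\<close> is nearly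
  constant, and orthogonality forces \<open>X\<^sub>i\<close> and \<open>Y\<^sub>i\<close> to tend to \<open>0\<close> uniformly. The differential equations
  carry this over to all derivatives. Finally \<open>O\<close> lies in all regions: through a point in the
  exterior of \<open>M\<^sub>i\<close> there is exactly one tangent per period, which contradicts orthogonality.
\<close>

section \<open>Brackets and polar angles\<close>

lemma bracket_altdef: "bracket x y = x$1 * y$2 - x$2 * y$1"
  by (simp add: bracket_def det_2 transpose_def)

lemma bounded_bilinear_bracket: "bounded_bilinear bracket"
proof
  show "\<exists>K. \<forall>a b. norm (bracket a b) \<le> norm a * norm b * K"
  proof (intro exI allI)
    fix a b :: "real^2"
    have *: "\<bar>x$i\<bar> \<le> norm x" for x :: "real^2" and i by (rule component_le_norm_cart)
    have "\<bar>a$1 * b$2\<bar> \<le> norm a * norm b" "\<bar>a$2 * b$1\<bar> \<le> norm a * norm b"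
      unfolding abs_mult by (intro mult_mono *; simp)+
    then show "norm (bracket a b) \<le> norm a * norm b * 2"
      by (simp add: bracket_altdef)
  qed
qed (auto simp: bracket_altdef algebra_simps)

interpretation bracket: bounded_bilinear bracket
  by (rule bounded_bilinear_bracket)

lemma bracket_self [simp]: "bracket x x = 0"
  by (simp add: bracket_altdef)

lemma bracket_commute: "bracket y x = - bracket x y"
  by (simp add: bracket_altdef)

text \<open>Cramer's rule for a basis of determinant one.\<close>

lemma bracket_basis_expansion:
  assumes "bracket u v = 1"
  shows "z = bracket z v *\<^sub>R u + bracket u z *\<^sub>R v"
proof -
  have uv: "u$1 * v$2 = 1 + u$2 * v$1"
    using assms by (simp add: bracket_altdef)
  have *: "bracket z v * u$1 + bracket u z * v$1 = z$1 * (u$1 * v$2 - u$2 * v$1)"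
       "bracket z v * u$2 + bracket u z * v$2 = z$2 * (u$1 * v$2 - u$2 * v$1)"
    by (simp_all only: bracket_altdef) (simp_all add: algebra_simps)
  show ?thesis
    using * uv by (simp add: vec_eq_iff forall_2)
qed

lemma has_real_derivative_bracket:
  assumes "(f has_vector_derivative f') (at t)" "(g has_vector_derivative g') (at t)"
  shows "((\<lambda>t. bracket (f t) (g t)) has_real_derivative bracket f' (g t) + bracket (f t) g') (at t)"
  using bracket.has_vector_derivative[OF assms]
  by (simp add: has_real_derivative_iff_has_vector_derivative add.commute)

lemma has_vector_derivative_shift:
  assumes "(f has_vector_derivative f') (at (t + a))"
  shows "((\<lambda>x. f (x + a)) has_vector_derivative f') (at t)"
proof -
  have "((\<lambda>x. x + a) has_vector_derivative 1) (at t)"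
    by (auto simp flip: has_real_derivative_iff_has_vector_derivative intro!: derivative_eq_intros)
  from vector_diff_chain_at[OF this assms] show ?thesis by (simp add: o_def)
qed

text \<open>Just after \<open>a\<close> the function is above \<open>c\<close>; a first return to
  the level would be approached from above, against \<open>left\<close>. The hypotheses are local
  comparisons because the angles to which this is applied are only known to be continuous.\<close>

lemma gt_level_if_crosses_upwards:
  fixes \<psi> :: "real \<Rightarrow> real"
  assumes cont: "continuous_on {a..b} \<psi>" and start: "\<psi> a = c"
    and right: "\<And>t. t \<in> {a..b} \<Longrightarrow> \<psi> t = c \<Longrightarrow> \<exists>d>0. \<forall>x\<in>{a..b}. t < x \<longrightarrow> x < t + d \<longrightarrow> \<psi> x > c"
    and left: "\<And>t. t \<in> {a..b} \<Longrightarrow> \<psi> t = c \<Longrightarrow> \<exists>d>0. \<forall>x\<in>{a..b}. t - d < x \<longrightarrow> x < t \<longrightarrow> \<psi> x < c"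
    and t: "a < t" "t \<le> b"
  shows "\<psi> t > c"
proof (rule ccontr)
  assume "\<not> \<psi> t > c"
  obtain d where d: "d > 0" "\<And>x. x \<in> {a..b} \<Longrightarrow> a < x \<Longrightarrow> x < a + d \<Longrightarrow> \<psi> x > c"
    using right[of a] start t by auto
  \<comment> \<open>A starting point already above the level, so that the first return is found
    strictly after it.\<close>
  define a' where "a' = a + min d (t - a) / 2"
  have a': "a < a'" "a' < t" "a' < a + d"
    using d(1) t by (auto simp: a'_def min_def field_simps)
  then have "\<psi> a' > c"
    using d(2)[of a'] t by auto
  define S where "S = {x \<in> {a'..t}. \<psi> x \<in> {..c}}"
  have conts: "continuous_on {a'..t} \<psi>"
    by (rule continuous_on_subset[OF cont]) (use a' t in auto)
  have "S = {a'..t} \<inter> \<psi> -` {..c}"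
    by (auto simp: S_def)
  then have "compact S"
    using continuous_closed_preimage[OF conts closed_atLeastAtMost closed_atMost, of c]
    by (metis bounded_closed_interval bounded_Int compact_eq_bounded_closed)
  moreover have "t \<in> S"
    using \<open>\<not> \<psi> t > c\<close> a' by (auto simp: S_def)
  ultimately obtain s where s: "s \<in> S" "\<And>x. x \<in> S \<Longrightarrow> s \<le> x"
    using compact_attains_inf[of S] by blast
  have s': "a' < s" "s \<le> t" "\<psi> s \<le> c"
    using s(1) \<open>\<psi> a' > c\<close> by (auto simp: S_def intro: le_neq_trans)
  have above: "\<psi> x > c" if "a' \<le> x" "x < s" for x
    using s(2)[of x] s' that by (force simp: S_def)
  have "\<exists>x\<ge>a'. x \<le> s \<and> \<psi> x = c"
    by (rule IVT2') (use s' \<open>\<psi> a' > c\<close> in \<open>auto intro: continuous_on_subset[OF conts]\<close>)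
  then have "\<psi> s = c"
    using above by (metis order_le_less less_irrefl)
  then obtain e where e: "e > 0" "\<And>x. x \<in> {a..b} \<Longrightarrow> s - e < x \<Longrightarrow> x < s \<Longrightarrow> \<psi> x < c"
    using left[of s] s' a' t by auto
  define x where "x = max a' (s - e / 2)"
  have "x < s" "a' \<le> x" "s - e < x"
    using e(1) s' by (auto simp: x_def)
  then show False
    using above[of x] e(2)[of x] a' s' t by auto
qed

section \<open>Transfer to the complex plane, where winding numbers and logarithms of paths are
  available\<close>

definition to_complex :: "real^2 \<Rightarrow> complex" where
  "to_complex x = Complex (x$1) (x$2)"

lemma norm_to_complex: "norm (to_complex x) = norm x"
  by (simp add: to_complex_def cmod_def norm_vec_def L2_set_def sum_2)

lemma bounded_linear_to_complex: "bounded_linear to_complex"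
  by (rule bounded_linear_intro[of _ 1])
     (auto simp: to_complex_def norm_to_complex complex_eq_iff simp flip: norm_to_complex)

lemma inj_to_complex: "inj to_complex"
  by (auto simp: inj_on_def to_complex_def vec_eq_iff forall_2)

text \<open>The map is an injective isometry, so it carries the unbounded component of
  \<open>P\<close> to an unbounded connected set that avoids the image of \<open>S\<close>.\<close>

lemma to_complex_in_outside:
  assumes "P \<in> outside S"
  shows "to_complex P \<in> outside (to_complex ` S)"
proof -
  interpret bounded_linear to_complex by (rule bounded_linear_to_complex)
  let ?C = "connected_component_set (- S) P"
  have P: "P \<notin> S" "\<not> bounded ?C"
    using assms by (auto simp: outside_def)
  have "connected (to_complex ` ?C)"
    by (intro connected_continuous_image connected_connected_component continuous_on
              continuous_on_id)
  moreover have "to_complex P \<in> to_complex ` ?C"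
    using P(1) by (intro imageI) (simp add: connected_component_refl_eq)
  moreover have "to_complex ` ?C \<subseteq> - to_complex ` S"
    using connected_component_subset[of "- S" P] inj_to_complex by (auto simp: inj_on_def)
  ultimately have "to_complex ` ?C \<subseteq> connected_component_set (- to_complex ` S) (to_complex P)"
    by (intro connected_component_maximal)
  moreover have "\<not> bounded (to_complex ` ?C)"
    using P(2) by (auto simp: bounded_iff norm_to_complex)
  ultimately show ?thesis
    by (auto simp: outside dest: bounded_subset)
qed

section \<open>Tangents from exterior points\<close>

definition unit_dir :: "real \<Rightarrow> real^2" where
  "unit_dir x = vector [cos x, sin x]"

lemma bracket_unit_dir: "bracket (unit_dir x) (unit_dir y) = sin (y - x)"
  by (simp add: bracket_altdef unit_dir_def sin_diff)

lemma unit_dir_eq_neg_one_power: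
  assumes "x - y = of_int n * pi"
  shows "unit_dir y = (-1) powi n *\<^sub>R unit_dir x"
proof -
  have y: "y = x - of_int n * pi"
    using assms by simp
  have "cos (of_int n * pi) = (-1) powi n" "sin (of_int n * pi) = 0"
    using cos_npi_int[of n] sin_npi_int[of n] by (auto simp: power_int_minus_left mult.commute)
  then show ?thesis
    unfolding y by (auto simp: unit_dir_def vec_eq_iff forall_2 cos_diff sin_diff)
qed

lemma to_complex_cis: "to_complex (r *\<^sub>R unit_dir x) = of_real r * cis x"
  by (simp add: to_complex_def unit_dir_def complex_eq_iff)

text \<open>The winding number about an exterior point is zero, so a continuous logarithm of
  \<open>K - P\<close> returns to its initial value. Its imaginary part is the angle \<phi>, the
  exponential of its real part is the radius \<open>R\<close>.\<close>

lemma outside_polar_angle: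
  fixes K :: "real \<Rightarrow> real^2"
  assumes cont: "continuous_on {a..b} K" and closed: "K b = K a" and ab: "a < b"
    and out: "P \<in> outside (K ` {a..b})"
  obtains R \<phi> where "continuous_on {a..b} \<phi>" "\<phi> b = \<phi> a" "\<And>t. R t > 0"
    "\<And>t. t \<in> {a..b} \<Longrightarrow> K t - P = R t *\<^sub>R unit_dir (\<phi> t)"
proof -
  interpret to_complex: bounded_linear to_complex by (rule bounded_linear_to_complex)
  define p where "p = (\<lambda>x. to_complex (K (a + (b - a) * x)))"
  have img: "(\<lambda>x. a + (b - a) * x) ` {0..1} = {a..b}"
    using ab image_affinity_atLeastAtMost[of "b - a" a 0 1] by (auto simp: add.commute)
  have path: "path p"
    unfolding path_def p_def
    by (intro to_complex.continuous_on continuous_on_compose2[OF cont] continuous_intros)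
       (simp flip: img)
  have "path_image p = to_complex ` K ` {a..b}"
    by (simp add: path_image_def p_def image_image flip: img)
  then have out': "to_complex P \<in> outside (path_image p)"
    using to_complex_in_outside[OF out] by simp
  then have notin: "to_complex P \<notin> path_image p"
    by (auto simp: outside_def)
  obtain q where
    q: "path q" "pathfinish q - pathstart q = 2 * of_real pi * \<i> * winding_number p (to_complex P)"
       "\<And>t. t \<in> {0..1} \<Longrightarrow> p t = to_complex P + exp (q t)"
    using winding_number_as_continuous_log[OF path notin] by metis
  have "pathfinish p = pathstart p"
    by (simp add: pathfinish_def pathstart_def p_def closed)
  then have "winding_number p (to_complex P) = 0"
    by (rule winding_number_zero_in_outside[OF path _ out'])
  then have q01: "q 1 = q 0"
    using q(2) by (simp add: pathfinish_def pathstart_def)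
  define f where "f = (\<lambda>t. (t - a) / (b - a))"
  have f: "f t \<in> {0..1}" if "t \<in> {a..b}" for t
    using that ab by (auto simp: f_def field_simps)
  show thesis
  proof (rule that)
    have "continuous_on {a..b} f"
      unfolding f_def using ab by (intro continuous_intros) auto
    then have "continuous_on {a..b} (\<lambda>t. q (f t))"
      by (rule continuous_on_compose2[OF q(1)[unfolded path_def]]) (use f in auto)
    then show "continuous_on {a..b} (\<lambda>t. Im (q (f t)))"
      by (rule continuous_on_Im)
    show "Im (q (f b)) = Im (q (f a))"
      using ab q01 by (simp add: f_def)
    show "K t - P = exp (Re (q (f t))) *\<^sub>R unit_dir (Im (q (f t)))" if t: "t \<in> {a..b}" for t
    proof -
      have "a + (b - a) * f t = t"
        using ab by (simp add: f_def)
      then have "to_complex (K t) = to_complex P + exp (q (f t))"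
        using q(3)[OF f[OF t]] by (simp add: p_def)
      also have "exp (q (f t)) = to_complex (exp (Re (q (f t))) *\<^sub>R unit_dir (Im (q (f t))))"
        by (simp add: to_complex_cis exp_eq_polar)
      finally show ?thesis
        using inj_to_complex by (simp add: to_complex.add[symmetric] inj_eq algebra_simps)
    qed
  qed simp
qed

text \<open>
  The angle from the curve's position vector relative to \<open>P\<close> to the tangent direction grows by \<open>\<pi>\<close>
  over a period, because the position vector does not wind around the exterior point \<open>P\<close>. At a
  tangent through \<open>P\<close> this angle can only cross a multiple of \<open>\<pi>\<close> upwards.
\<close>
lemma one_tangent_from_outside:
  fixes K b b' :: "real \<Rightarrow> real^2" and r \<tau> l :: "real \<Rightarrow> real"
  assumes per: "\<And>t. K (t + pi) = K t"
    and K: "\<And>t. (K has_vector_derivative l t *\<^sub>R b t) (at t)"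
    and b: "\<And>t. (b has_vector_derivative b' t) (at t)"
    and turn: "\<And>t. bracket (b t) (b' t) > 0"
    and polar: "\<And>t. b t = r t *\<^sub>R unit_dir (\<tau> t)" "\<And>t. r t > 0"
    and \<tau>: "continuous_on UNIV \<tau>" "\<And>t. \<tau> (t + pi) = \<tau> t + pi"
    and out: "P \<in> outside (range K)"
    and zero: "bracket (P - K s) (b s) = 0" and t: "s < t" "t < s + pi"
  shows "bracket (P - K t) (b t) \<noteq> 0"
proof
  assume zero': "bracket (P - K t) (b t) = 0"
  have "continuous_on {s..s+pi} K"
    using K by (meson continuous_at_imp_continuous_on has_vector_derivative_continuous)
  moreover have "P \<in> outside (K ` {s..s+pi})"
    using out outside_mono[of "K ` {s..s+pi}" "range K"] by auto
  ultimately obtain R \<phi> where \<phi>: "continuous_on {s..s+pi} \<phi>" "\<phi> (s + pi) = \<phi> s"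
    and R: "\<And>t. R t > 0" and KP: "\<And>t. t \<in> {s..s+pi} \<Longrightarrow> K t - P = R t *\<^sub>R unit_dir (\<phi> t)"
    using outside_polar_angle[of s "s + pi" K P] per pi_gt_zero by (metis less_add_same_cancel1)
  \<comment> \<open>The angle from \<open>K - P\<close> to the tangent direction \<open>b\<close>;
    the tangent at \<open>x\<close> passes through \<open>P\<close> exactly when \<psi> is a
    multiple of \<pi> there.\<close>
  define \<psi> where "\<psi> = (\<lambda>t. \<tau> t - \<phi> t)"
  define F where "F = (\<lambda>t. bracket (K t - P) (b t))"
  have F: "F x = R x * r x * sin (\<psi> x)" if "x \<in> {s..s+pi}" for x
    using KP[OF that]
    by (simp add: F_def polar(1) bracket.scaleR_left bracket.scaleR_right bracket_unit_dir \<psi>_def)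
  have F0: "(F x = 0) = (bracket (P - K x) (b x) = 0)" for x
    by (simp add: F_def bracket.diff_left) linarith
  have psi_zero: "\<exists>n::int. \<psi> x = of_int n * pi" if "x \<in> {s..s+pi}" "F x = 0" for x
    using F[OF that(1)] that(2) R[of x] polar(2)[of x] by (simp add: sin_zero_iff_int2)
  have cont\<psi>: "continuous_on {s..s+pi} \<psi>"
    unfolding \<psi>_def by (intro continuous_intros \<phi> continuous_on_subset[OF \<tau>(1)]) auto
  \<comment> \<open>Since the derivative of \<open>K\<close> is parallel to \<open>b\<close>, the
    derivative of \<open>F\<close> at a zero comes only from the turning of \<open>b\<close>. The
    sign \<open>(-1) powi n\<close> makes \<open>F\<close> increase there and turns the sine of
    \<psi> into that of \<psi> minus the level.\<close>
  have cross: "\<exists>d>0. \<forall>x\<in>{s..s+pi}. (z < x \<longrightarrow> x < z + d \<longrightarrow> \<psi> x > of_int n * pi) \<and>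
                     (z - d < x \<longrightarrow> x < z \<longrightarrow> \<psi> x < of_int n * pi)"
    if z: "z \<in> {s..s+pi}" and n: "\<psi> z = of_int n * pi" for z and n :: int
  proof -
    define \<epsilon> :: real where "\<epsilon> = (-1) powi n"
    have \<epsilon>: "\<epsilon> = 1 \<or> \<epsilon> = -1"
      by (auto simp: \<epsilon>_def power_int_minus_left)
    have "K z - P = (R z * \<epsilon>) *\<^sub>R unit_dir (\<tau> z)"
      using KP[OF z] unit_dir_eq_neg_one_power[of "\<tau> z" "\<phi> z" n] n by (simp add: \<psi>_def \<epsilon>_def)
    also have "\<dots> = (R z * \<epsilon> / r z) *\<^sub>R b z"
      using polar(2)[of z] by (simp add: polar(1))
    finally have KPz: "K z - P = (R z * \<epsilon> / r z) *\<^sub>R b z" .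
    have "(F has_real_derivative bracket (l z *\<^sub>R b z) (b z) + bracket (K z - P) (b' z)) (at z)"
      unfolding F_def
      by (rule has_real_derivative_bracket) (auto intro!: derivative_eq_intros K b)
    then have "(F has_real_derivative R z * \<epsilon> / r z * bracket (b z) (b' z)) (at z)"
      unfolding KPz by (simp add: bracket.scaleR_left)
    then have "((\<lambda>x. \<epsilon> * F x) has_real_derivative \<epsilon> * (R z * \<epsilon> / r z * bracket (b z) (b' z))) (at z)"
      by (rule DERIV_cmult)
    moreover have "\<epsilon> * (R z * \<epsilon> / r z * bracket (b z) (b' z)) > 0"
      using \<epsilon> R[of z] polar(2)[of z] turn[of z] by auto
    ultimately obtain d1 d2 where d1: "d1 > 0" "\<And>h. 0 < h \<Longrightarrow> h < d1 \<Longrightarrow> \<epsilon> * F z < \<epsilon> * F (z + h)"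
      and d2: "d2 > 0" "\<And>h. 0 < h \<Longrightarrow> h < d2 \<Longrightarrow> \<epsilon> * F (z - h) < \<epsilon> * F z"
      using DERIV_pos_inc_right[of "\<lambda>x. \<epsilon> * F x"] DERIV_pos_inc_left[of "\<lambda>x. \<epsilon> * F x"] by metis
    have "F z = 0"
      using F[OF z] n by (simp add: sin_zero_iff_int2)
    have \<epsilon>F: "\<epsilon> * F x = R x * r x * sin (\<psi> x - of_int n * pi)" if "x \<in> {s..s+pi}" for x
      using F[OF that] by (simp add: \<epsilon>_def sin_diff cos_npi_int[of n, simplified mult.commute]
        sin_npi_int[of n, simplified mult.commute] power_int_minus_left mult.commute)
    \<comment> \<open>Within distance \<pi> of the level, the sign of the sine decides on which side
      of the level \<psi> lies.\<close>
    obtain d3 where d3: "d3 > 0" "\<And>x. x \<in> {s..s+pi} \<Longrightarrow> \<bar>x - z\<bar> < d3 \<Longrightarrow> \<bar>\<psi> x - of_int n * pi\<bar> < pi"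
      using cont\<psi> z n unfolding continuous_on_iff dist_real_def by (metis pi_gt_zero)
    have sgn: "sin (\<psi> x - of_int n * pi) > 0 \<longleftrightarrow> \<epsilon> * F x > 0"
              "sin (\<psi> x - of_int n * pi) < 0 \<longleftrightarrow> \<epsilon> * F x < 0" if "x \<in> {s..s+pi}" for x
      using \<epsilon>F[OF that] R[of x] polar(2)[of x] by (simp_all add: zero_less_mult_iff mult_less_0_iff)
    show ?thesis
    proof (intro exI[of _ "min d3 (min d1 d2)"] conjI ballI impI)
      fix x assume x: "x \<in> {s..s+pi}" "z < x" "x < z + min d3 (min d1 d2)"
      then have "\<epsilon> * F x > 0"
        using d1(2)[of "x - z"] \<open>F z = 0\<close> by simp
      moreover have "\<bar>\<psi> x - of_int n * pi\<bar> < pi"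
        using d3(2)[of x] x by simp
      ultimately show "\<psi> x > of_int n * pi"
        using sgn[OF x(1)] sin_ge_zero[of "of_int n * pi - \<psi> x"] sin_minus[of "\<psi> x - of_int n * pi"]
        by (cases "\<psi> x > of_int n * pi") auto
    next
      fix x assume x: "x \<in> {s..s+pi}" "z - min d3 (min d1 d2) < x" "x < z"
      then have "\<epsilon> * F x < 0"
        using d2(2)[of "z - x"] \<open>F z = 0\<close> by simp
      moreover have "\<bar>\<psi> x - of_int n * pi\<bar> < pi"
        using d3(2)[of x] x by simp
      ultimately show "\<psi> x < of_int n * pi"
        using sgn[OF x(1)] sin_ge_zero[of "\<psi> x - of_int n * pi"]
        by (cases "\<psi> x < of_int n * pi") auto
    qed (use d1 d2 d3 in auto)
  qed
  have gt: "\<psi> y > of_int n * pi"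
    if x: "s \<le> x" "x < y" "y \<le> s + pi" and n: "\<psi> x = of_int n * pi" for x y and n :: int
  proof (rule gt_level_if_crosses_upwards[of x "s + pi" \<psi>])
    show "continuous_on {x..s+pi} \<psi>"
      by (rule continuous_on_subset[OF cont\<psi>]) (use x in auto)
    show "\<exists>d>0. \<forall>xa\<in>{x..s + pi}. z < xa \<longrightarrow> xa < z + d \<longrightarrow> \<psi> xa > of_int n * pi"
      if "z \<in> {x..s+pi}" "\<psi> z = of_int n * pi" for z
      using cross[of z n] that x by fastforce
    show "\<exists>d>0. \<forall>xa\<in>{x..s + pi}. z - d < xa \<longrightarrow> xa < z \<longrightarrow> \<psi> xa < of_int n * pi"
      if "z \<in> {x..s+pi}" "\<psi> z = of_int n * pi" for z
      using cross[of z n] that x by fastforce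
  qed (use x n in auto)
  obtain m where m: "\<psi> s = of_int m * pi"
    using psi_zero[of s] zero F0 by auto
  obtain n where n: "\<psi> t = of_int n * pi"
    using psi_zero[of t] zero' F0 t by auto
  \<comment> \<open>\<tau> gains \<pi> while \<phi> returns, so \<psi> gains exactly \<pi>. A
    tangent at \<open>t\<close> would need an integer strictly between \<open>m\<close> and
    \<open>m + 1\<close>.\<close>
  have "\<psi> (s + pi) = of_int (m + 1) * pi"
    using \<phi>(2) \<tau>(2)[of s] m by (simp add: \<psi>_def algebra_simps)
  moreover have "of_int m * pi < \<psi> t" "of_int n * pi < \<psi> (s + pi)"
    using gt[of s t m] gt[of t "s + pi" n] t m n by auto
  ultimately have "m < n" "n < m + 1"
    using n by (simp_all del: of_int_add)
  then show False by simp
qed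

section \<open>Antiperiodic functions\<close>

lemma has_vector_derivative_moving_integral:
  fixes f :: "real \<Rightarrow> 'a::banach"
  assumes f: "continuous_on UNIV f" and c: "c \<ge> 0"
  shows "((\<lambda>t. integral {t..t + c} f) has_vector_derivative f (t + c) - f t) (at t)"
proof -
  \<comment> \<open>The margin of 1 puts both moving end points into the interior of the interval of
    the antiderivative.\<close>
  define I where "I = {t - 1..t + c + 1}"
  obtain G where G: "\<And>x. x \<in> I \<Longrightarrow> (G has_vector_derivative f x) (at x within I)"
    unfolding I_def by (metis antiderivative_continuous continuous_on_subset[OF f subset_UNIV])
  have at: "(G has_vector_derivative f x) (at x)" if "t - 1 < x" "x < t + c + 1" for x
    using G[of x] that at_within_Icc_at[of "t - 1" x "t + c + 1"] by (simp add: I_def)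
  have int: "integral {x..x + c} f = G (x + c) - G x" if x: "x \<in> {t - 1<..<t + 1}" for x
  proof (rule integral_unique, rule fundamental_theorem_of_calculus)
    show "(G has_vector_derivative f y) (at y within {x..x + c})" if "y \<in> {x..x + c}" for y
      using x that by (intro has_vector_derivative_at_within[OF at]) auto
  qed (use c in simp)
  have "((\<lambda>x. G (x + c)) has_vector_derivative f (t + c)) (at t)"
    by (intro has_vector_derivative_shift at) (use c in auto)
  then have "((\<lambda>x. G (x + c) - G x) has_vector_derivative f (t + c) - f t) (at t)"
    using at[of t] c by (auto intro!: derivative_eq_intros)
  then show ?thesis
    by (rule has_vector_derivative_transform_within_open[of _ _ _ "{t - 1<..<t + 1}"])
       (auto simp: int)
qed

lemma integral_periodic_shift:
  fixes f :: "real \<Rightarrow> 'a::banach"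
  assumes "continuous_on UNIV f" and per: "\<And>t. f (t + c) = f t" and "c \<ge> 0"
  shows "integral {s..s + c} f = integral {0..c} f"
proof -
  have "((\<lambda>t. integral {t..t + c} f) has_vector_derivative 0) (at t)" for t
    using has_vector_derivative_moving_integral[OF assms(1,3), of t] by (simp add: per)
  then obtain k where "\<And>t. integral {t..t + c} f = k"
    using has_vector_derivative_zero_constant[of UNIV "\<lambda>t. integral {t..t + c} f"] by auto
  from this[of s] this[of 0] show ?thesis by simp
qed

lemma has_integral_derivative_periodic:
  fixes h :: "real \<Rightarrow> 'a::banach"
  assumes "\<And>t. (h has_vector_derivative h' t) (at t)" "\<And>t. h (t + c) = h t" "c \<ge> 0"
  shows "(h' has_integral 0) {0..c}"
  using fundamental_theorem_of_calculus[of 0 c h h'] assms assms(2)[of 0]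
  by (simp add: has_vector_derivative_at_within)

lemma antiperiodic_eq_integral:
  fixes g :: "real \<Rightarrow> 'a::banach"
  assumes "\<And>t. (g has_vector_derivative f t) (at t)" "\<And>t. g (t + c) = - g t" "c \<ge> 0"
  shows "g t = - (1/2) *\<^sub>R integral {t..t + c} f"
proof -
  have "(f has_integral (g (t + c) - g t)) {t..t + c}"
    by (rule fundamental_theorem_of_calculus) (use assms in \<open>auto simp: has_vector_derivative_at_within\<close>)
  then have "integral {t..t + c} f = - g t - g t"
    by (simp add: integral_unique assms(2))
  also have "\<dots> = - 2 *\<^sub>R g t"
    by (simp add: scaleR_2)
  finally show ?thesis by simp
qed

text \<open>By connectedness \<open>f\<close> keeps one sign inside the interval; multiplying by the
  single value \<open>f m\<close> makes it positive.\<close>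

lemma integral_nonzero_if_nonvanishing:
  fixes f :: "real \<Rightarrow> real"
  assumes cont: "continuous_on {a..b} f" and "a < b" and nz: "\<And>t. a < t \<Longrightarrow> t < b \<Longrightarrow> f t \<noteq> 0"
  shows "integral {a..b} f \<noteq> 0"
proof -
  define m where "m = (a + b) / 2"
  have m: "a < m" "m < b"
    using \<open>a < b\<close> by (auto simp: m_def)
  have same: "f x * f m > 0" if "a < x" "x < b" for x
  proof (rule ccontr)
    assume "\<not> f x * f m > 0"
    then have "(f x \<le> 0 \<and> 0 \<le> f m) \<or> (f m \<le> 0 \<and> 0 \<le> f x)"
      by (auto simp: zero_less_mult_iff not_less)
    moreover have "connected (f ` {a<..<b})"
      by (intro connected_continuous_image continuous_on_subset[OF cont]) auto
    ultimately have "0 \<in> f ` {a<..<b}"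
      using that m unfolding connected_iff_interval by (meson greaterThanLessThan_iff imageI)
    then show False using nz by auto
  qed
  have "integral {a..b} (\<lambda>x. 0) < integral {a..b} (\<lambda>x. f x * f m)"
    using integral_less[of a b "\<lambda>x. 0" "\<lambda>x. f x * f m"] same \<open>a < b\<close>
      continuous_on_mult_right[OF cont, of "f m"] by auto
  then show ?thesis
    by auto
qed

text \<open>The square vanishes to second order and \<open>g\<close> only to first, so the quotient
  tends to 0, which is also its value at \<open>z\<close> because \<open>f z = 0\<close>. This
  controls boundary terms with a vanishing denominator.\<close>

lemma isCont_square_over_simple_zero:
  fixes f g h :: "real \<Rightarrow> real"
  assumes f: "(f has_real_derivative f') (at z)" "f z = 0"
    and g: "(g has_real_derivative g') (at z)" "g z = 0" "g' \<noteq> 0"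
    and h: "isCont h z"
  shows "isCont (\<lambda>t. (f t)\<^sup>2 * h t / g t) z"
proof -
  have "((\<lambda>t. (f t / (t - z)) * f t * h t / (g t / (t - z))) \<longlongrightarrow> f' * f z * h z / g') (at z)"
    using f g(1)[unfolded has_field_derivative_iff] DERIV_isCont[OF f(1)] h
    by (intro tendsto_intros) (auto simp: has_field_derivative_iff g isCont_def)
  then have "((\<lambda>t. (f t)\<^sup>2 * h t / g t) \<longlongrightarrow> f' * f z * h z / g') (at z)"
    by (rule Lim_transform_eventually) (auto simp: eventually_at_filter power2_eq_square)
  then show ?thesis
    by (simp add: isCont_def f g)
qed

text \<open>The vector never vanishes and its direction turns by exactly \<pi> over a parameter
  interval of length \<pi>. The angle is only required to be continuous, which is what a logarithm
  provides.\<close>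

definition half_turn :: "(real \<Rightarrow> real^2) \<Rightarrow> bool" where
  "half_turn b \<longleftrightarrow> (\<exists>r \<tau>. (\<forall>t. r t > 0) \<and> (\<forall>t. b t = r t *\<^sub>R unit_dir (\<tau> t)) \<and>
     continuous_on UNIV \<tau> \<and> (\<forall>t. \<tau> (t + pi) = \<tau> t + pi))"

text \<open>\<open>a\<close> always lies in the open half plane on the clockwise side of
  \<open>b\<close>, so the angle between them has a continuous \<pi>-periodic choice, and
  \<open>a\<close> inherits the total turn of \<open>b\<close>.\<close>

lemma half_turn_of_positive_bracket:
  assumes b: "half_turn b" and a: "continuous_on UNIV a" "\<And>t. a (t + pi) = - a t"
    and pos: "\<And>t. bracket (a t) (b t) > 0"
  shows "half_turn a"
proof -
  obtain r \<tau> where r: "\<And>t. r t > 0" "\<And>t. b t = r t *\<^sub>R unit_dir (\<tau> t)"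
    and \<tau>: "continuous_on UNIV \<tau>" "\<And>t. \<tau> (t + pi) = \<tau> t + pi"
    using b by (auto simp: half_turn_def)
  \<comment> \<open>Rotation by \<open>pi / 2 - \<tau> t\<close> moves \<open>a t\<close> into the
    right half plane, where the principal logarithm is continuous.\<close>
  define z where "z = (\<lambda>t. \<i> * to_complex (a t) * cis (- \<tau> t))"
  have "Re (z t) = bracket (a t) (unit_dir (\<tau> t))" for t
    by (simp add: z_def to_complex_def unit_dir_def bracket_altdef)
  also have "\<dots> t = bracket (a t) (b t) / r t" for t
    using r(1)[of t] by (simp add: r(2) bracket.scaleR_right)
  finally have Re: "Re (z t) > 0" for t
    using pos[of t] r(1)[of t] by simp
  have "continuous_on UNIV z"
    unfolding z_def
    by (intro continuous_intros bounded_linear.continuous_on[OF bounded_linear_to_complex] a \<tau>)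
  then have "continuous_on UNIV (\<lambda>t. Ln (z t))"
    by (rule continuous_on_Ln') (use Re in \<open>auto simp: complex_nonpos_Reals_iff not_le\<close>)
  then have cont: "continuous_on UNIV (\<lambda>t. Im (Ln (z t)))"
    by (rule continuous_on_Im)
  have per: "z (t + pi) = z t" for t
  proof -
    have "to_complex (- a t) = - to_complex (a t)" "cis (- (\<tau> t + pi)) = - cis (- \<tau> t)"
      by (simp_all add: to_complex_def complex_eq_iff)
    then show ?thesis by (simp add: z_def a \<tau>)
  qed
  have pol: "a t = cmod (z t) *\<^sub>R unit_dir (\<tau> t - pi / 2 + Im (Ln (z t)))" for t
  proof -
    have "z t \<noteq> 0" using Re[of t] by auto
    have "to_complex (a t) = z t * cis (\<tau> t - pi / 2)"
      by (simp add: z_def cis_mult mult.assoc complex_eq_iff)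
    also have "z t = of_real (cmod (z t)) * cis (Im (Ln (z t)))"
      using \<open>z t \<noteq> 0\<close> by (metis Im_Ln_eq Arg_def cis_Arg rcis_cmod_Arg rcis_def)
    finally have "to_complex (a t) = to_complex (cmod (z t) *\<^sub>R unit_dir (\<tau> t - pi / 2 + Im (Ln (z t))))"
      by (simp add: to_complex_cis cis_mult mult.assoc add.commute)
    then show ?thesis
      using inj_to_complex by (simp add: inj_eq)
  qed
  show ?thesis
    unfolding half_turn_def
  proof (intro exI conjI allI)
    show "cmod (z t) > 0" for t using Re[of t] by auto
    show "continuous_on UNIV (\<lambda>t. \<tau> t - pi / 2 + Im (Ln (z t)))"
      by (intro continuous_intros cont \<tau>)
  qed (use pol per \<tau> in auto)
qed

section \<open>Dual pairs of symmetric curves\<close>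

text \<open>\<open>w\<close> and \<open>q\<close> stand for \<open>[u, u']\<close> and
  \<open>[v, v']\<close>. The assumptions are self-dual: they survive replacing
  \<open>(u, v, w, q)\<close> by \<open>(- v, u, q, w)\<close>.\<close>

locale frame =
  fixes u v :: "real \<Rightarrow> real^2" and w q :: "real \<Rightarrow> real"
  assumes u_deriv: "\<And>t. (u has_vector_derivative w t *\<^sub>R v t) (at t)"
    and v_deriv: "\<And>t. (v has_vector_derivative - q t *\<^sub>R u t) (at t)"
    and bracket_uv [simp]: "\<And>t. bracket (u t) (v t) = 1"
    and w_pos: "\<And>t. w t > 0" and q_pos: "\<And>t. q t > 0"
    and w_cont: "continuous_on UNIV w" and q_cont: "continuous_on UNIV q"
    and u_anti [simp]: "\<And>t. u (t + pi) = - u t" and v_anti [simp]: "\<And>t. v (t + pi) = - v t"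
    and w_per [simp]: "\<And>t. w (t + pi) = w t" and q_per [simp]: "\<And>t. q (t + pi) = q t"
    and v_half_turn: "half_turn v"
begin

lemma bracket_vu [simp]: "bracket (v t) (u t) = -1"
  by (simp add: bracket_commute[of "v t"])

lemma cont_w [continuous_intros]: "continuous_on S w"
  by (rule continuous_on_subset[OF w_cont]) simp

lemma cont_q [continuous_intros]: "continuous_on S q"
  by (rule continuous_on_subset[OF q_cont]) simp

lemma cont_u [continuous_intros]: "continuous_on S u"
  by (rule continuous_at_imp_continuous_on) (blast intro: has_vector_derivative_continuous u_deriv)

lemma cont_v [continuous_intros]: "continuous_on S v"
  by (rule continuous_at_imp_continuous_on) (blast intro: has_vector_derivative_continuous v_deriv)

text \<open>Exchanges the two kinds of involutes: facts about curves tangent to \<open>v\<close>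
  become facts about curves tangent to \<open>u\<close>. The half turn passes from \<open>v\<close>
  to \<open>u\<close> because \<open>[u, v] = 1\<close> is positive.\<close>

lemma dual: "frame (\<lambda>t. - v t) u q w"
proof
  show "((\<lambda>t. - v t) has_vector_derivative q t *\<^sub>R u t) (at t)" for t
    using has_vector_derivative_minus[OF v_deriv[of t]] by simp
  show "(u has_vector_derivative - w t *\<^sub>R - v t) (at t)" for t
    using u_deriv[of t] by simp
  show "half_turn u"
    by (rule half_turn_of_positive_bracket[OF v_half_turn]) (auto intro: cont_u)
qed (auto simp: w_pos q_pos w_cont q_cont bracket.minus_left)

lemma one_tangent:
  assumes "\<And>t. K (t + pi) = K t"
    and "\<And>t. (K has_vector_derivative l t *\<^sub>R v t) (at t)"
    and "P \<in> outside (range K)"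
    and "bracket (P - K s) (v s) = 0" and "s < t" "t < s + pi"
  shows "bracket (P - K t) (v t) \<noteq> 0"
proof -
  obtain r \<tau> where r: "\<And>t. v t = r t *\<^sub>R unit_dir (\<tau> t)" "\<And>t. r t > 0"
    and \<tau>: "continuous_on UNIV \<tau>" "\<And>t. \<tau> (t + pi) = \<tau> t + pi"
    using v_half_turn by (auto simp: half_turn_def)
  have "bracket (v t) (- q t *\<^sub>R u t) > 0" for t
    using q_pos by (simp add: bracket.scaleR_right bracket.minus_right)
  from one_tangent_from_outside[OF assms(1,2) v_deriv this r \<tau> assms(3-)]
  show ?thesis .
qed

text \<open>The point \<open>v s\<close> is exterior to the curve that is constantly 0, and
  \<open>[v s, v]\<close> vanishes at \<open>s\<close>; hence it cannot vanish again before
  \<open>s + pi\<close>.\<close>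

lemma bracket_v_v_nonzero:
  assumes "s < t" "t < s + pi"
  shows "bracket (v s) (v t) \<noteq> 0"
proof -
  have "v s \<noteq> 0"
    using bracket_uv[of s] by (metis bracket.zero_right zero_neq_one)
  then have "v s \<in> outside (range (\<lambda>t::real. 0))"
    by (simp add: outside_convex image_constant_conv)
  then show ?thesis
    using one_tangent[of "\<lambda>t. 0" "\<lambda>t. 0" "v s" s t] assms by simp
qed

lemma antiperiodic_zero:
  fixes f :: "real \<Rightarrow> real"
  assumes "continuous_on UNIV f" "\<And>t. f (t + c) = - f t" "c \<ge> 0"
  obtains s where "f s = 0"
proof -
  have "0 \<in> closed_segment (f 0) (f c)"
    using assms(2)[of 0] by (auto simp: closed_segment_eq_real_ivl)
  moreover have "connected (range f)"
    by (intro connected_continuous_image assms) auto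
  ultimately have "0 \<in> range f"
    by (metis connected_iff_interval closed_segment_eq_real_ivl atLeastAtMost_iff rangeI UNIV_I)
  then show ?thesis using that by auto
qed

text \<open>
  Otherwise the function \<open>[P - K, v]\<close> vanishes only once in a period, at \<open>s\<close> say, and so has the
  same sign changes as \<open>[v s, v]\<close>, to which it would be orthogonal.
\<close>
lemma not_outside_if_orthogonal:
  assumes per: "\<And>t. K (t + pi) = K t"
    and K: "\<And>t. (K has_vector_derivative l t *\<^sub>R v t) (at t)"
    and orth: "integral {0..pi} (\<lambda>t. (w t * bracket (P - K t) (v t)) *\<^sub>R v t) = 0"
  shows "P \<notin> outside (range K)"
proof
  assume P: "P \<in> outside (range K)"
  have contK: "continuous_on S K" for S
    by (rule continuous_at_imp_continuous_on) (blast intro: has_vector_derivative_continuous K)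
  define F where "F = (\<lambda>t. bracket (P - K t) (v t))"
  have contF: "continuous_on S F" for S
    unfolding F_def by (intro bracket.continuous_on continuous_intros contK)
  have antiF: "F (t + pi) = - F t" for t
    by (simp add: F_def per bracket.minus_right)
  obtain s where s: "F s = 0"
    using antiperiodic_zero[OF contF antiF] pi_ge_zero by blast
  define G where "G = (\<lambda>t. w t * F t * bracket (v s) (v t))"
  have contG: "continuous_on S G" for S
    unfolding G_def by (intro bracket.continuous_on continuous_intros contF)
  have "integral {s..s+pi} G \<noteq> 0"
  proof (rule integral_nonzero_if_nonvanishing[OF contG])
    show "G t \<noteq> 0" if "s < t" "t < s + pi" for t
      using one_tangent[OF per K P _ that] s bracket_v_v_nonzero[OF that] w_pos[of t]
      by (simp add: G_def F_def)
  qed simp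
  also have "integral {s..s+pi} G = integral {0..pi} G"
    by (rule integral_periodic_shift[OF contG]) (auto simp: G_def antiF bracket.minus_right)
  also have "\<dots> = integral {0..pi} (bracket (v s) \<circ> (\<lambda>t. (w t * F t) *\<^sub>R v t))"
    by (simp add: G_def bracket.scaleR_right o_def)
  also have "\<dots> = bracket (v s) (integral {0..pi} (\<lambda>t. (w t * F t) *\<^sub>R v t))"
    by (intro integral_linear integrable_continuous_real continuous_intros contF
              bracket.bounded_linear_right)
  also have "\<dots> = 0"
    using orth by (simp add: F_def bracket.zero_right)
  finally show False by simp
qed

text \<open>
  This is Picone's identity for \<open>f\<close> and the solution \<open>[v s, v]\<close> of the same equation, where \<open>s\<close> is
  a zero of \<open>f\<close>. The boundary terms vanish, \<open>H\<close> being \<open>0\<close> at both end points.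
\<close>
lemma wirtinger:
  fixes f y :: "real \<Rightarrow> real"
  assumes f: "\<And>t. (f has_real_derivative q t * y t) (at t)"
    and y: "continuous_on UNIV y"
    and anti: "\<And>t. f (t + pi) = - f t" "\<And>t. y (t + pi) = - y t"
  shows "integral {0..pi} (\<lambda>t. w t * (f t)\<^sup>2) \<le> integral {0..pi} (\<lambda>t. q t * (y t)\<^sup>2)"
proof -
  have contf [continuous_intros]: "continuous_on S f" for S
    by (rule continuous_at_imp_continuous_on) (blast intro: DERIV_isCont f)
  have conty [continuous_intros]: "continuous_on S y" for S
    by (rule continuous_on_subset[OF y]) simp
  obtain s where s: "f s = 0"
    using antiperiodic_zero[OF contf anti(1)] pi_ge_zero by blast
  \<comment> \<open>Up to sign the coordinates of the constant vector \<open>v s\<close>: they solve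
    \<open>g' = - q h\<close>, \<open>h' = w g\<close>, and \<open>g\<close> vanishes at
    \<open>s\<close> as \<open>f\<close> does.\<close>
  define g h where "g = (\<lambda>t. bracket (v s) (v t))" and "h = (\<lambda>t. bracket (v s) (u t))"
  have g: "(g has_real_derivative - q t * h t) (at t)" for t
    using has_real_derivative_bracket[OF has_vector_derivative_const v_deriv[of t], of "v s"]
    by (simp add: g_def h_def bracket.scaleR_right bracket.zero_left bracket.minus_right)
  have h: "(h has_real_derivative w t * g t) (at t)" for t
    using has_real_derivative_bracket[OF has_vector_derivative_const u_deriv[of t], of "v s"]
    by (simp add: g_def h_def bracket.scaleR_right bracket.zero_left)
  have g_nz: "g t \<noteq> 0" if "s < t" "t < s + pi" for t
    using bracket_v_v_nonzero[OF that] by (simp add: g_def)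
  define H where "H = (\<lambda>t. - ((f t)\<^sup>2 * h t / g t))"
  \<comment> \<open>Picone's identity: the integrand \<open>q y\<^sup>2 - w f\<^sup>2\<close>
    exceeds \<open>H'\<close> by the nonnegative term
    \<open>q (y + f h / g)\<^sup>2\<close>.\<close>
  define H' where "H' = (\<lambda>t. q t * (y t)\<^sup>2 - w t * (f t)\<^sup>2 - q t * (y t + f t * h t / g t)\<^sup>2)"
  have H: "(H has_real_derivative H' t) (at t)" if "s < t" "t < s + pi" for t
    unfolding H_def
    by (rule derivative_eq_intros f g h refl | simp add: g_nz[OF that])+
       (use g_nz[OF that] in \<open>simp add: H'_def field_simps power2_eq_square\<close>)
  have "isCont H t" if "t \<in> {s..s+pi}" for t
  proof (cases "t = s \<or> t = s + pi")
    case True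
    then have "f t = 0" "g t = 0" "- q t * h t \<noteq> 0"
      using s q_pos[of s] by (auto simp: anti g_def h_def bracket.minus_right)
    from isCont_square_over_simple_zero[OF f this(1) g this(2,3) DERIV_isCont[OF h]]
    show ?thesis by (simp add: H_def)
  next
    case False
    then show ?thesis using H[of t] that by (intro DERIV_isCont) auto
  qed
  \<comment> \<open>The derivative of \<open>H\<close> is known only in the interior, since
    \<open>g\<close> vanishes at both end points; there, continuity of \<open>H\<close>
    suffices.\<close>
  then have "(H' has_integral (H (s + pi) - H s)) {s..s+pi}"
    using H by (intro fundamental_theorem_of_calculus_interior continuous_at_imp_continuous_on)
      (auto simp: has_real_derivative_iff_has_vector_derivative)
  then have "(H' has_integral 0) {s..s+pi}"
    by (simp add: H_def s anti)
  moreover define E where "E = (\<lambda>t. q t * (y t)\<^sup>2 - w t * (f t)\<^sup>2)"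
  have contE: "continuous_on S E" for S
    unfolding E_def by (intro continuous_intros)
  have "(E has_integral integral {s..s+pi} E) {s..s+pi}"
    by (intro integrable_integral integrable_continuous_real contE)
  ultimately have "0 \<le> integral {s..s+pi} E"
    by (rule has_integral_le) (use q_pos in \<open>auto simp: E_def H'_def less_imp_le\<close>)
  also have "\<dots> = integral {0..pi} E"
    by (rule integral_periodic_shift[OF contE]) (auto simp: E_def anti)
  also have "\<dots> = integral {0..pi} (\<lambda>t. q t * (y t)\<^sup>2) - integral {0..pi} (\<lambda>t. w t * (f t)\<^sup>2)"
    unfolding E_def by (intro integral_diff integrable_continuous_real continuous_intros)
  finally show ?thesis by simp
qed

end

section \<open>The iteration in mean square\<close>

lemma tendsto_zero_squeeze:
  fixes f g :: "'a \<Rightarrow> real"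
  assumes "(g \<longlongrightarrow> 0) F" "\<And>x. 0 \<le> f x" "\<And>x. f x \<le> g x"
  shows "(f \<longlongrightarrow> 0) F"
  by (rule tendsto_sandwich[OF _ _ tendsto_const assms(1)]) (use assms in auto)

context frame
begin

text \<open>Expansion of the nonnegative integral of \<open>w (W |f| - I)\<^sup>2\<close>, which
  equals \<open>W (W J - I\<^sup>2)\<close>.\<close>

lemma weighted_cauchy_schwarz:
  fixes f :: "real \<Rightarrow> real"
  assumes f: "\<And>S. continuous_on S f"
  shows "(integral {0..pi} (\<lambda>t. w t * \<bar>f t\<bar>))\<^sup>2
           \<le> integral {0..pi} w * integral {0..pi} (\<lambda>t. w t * (f t)\<^sup>2)"
proof -
  note [continuous_intros] = f
  define W I J where "W = integral {0..pi} w" and "I = integral {0..pi} (\<lambda>t. w t * \<bar>f t\<bar>)"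
    and "J = integral {0..pi} (\<lambda>t. w t * (f t)\<^sup>2)"
  have int: "(w has_integral W) {0..pi}" "((\<lambda>t. w t * \<bar>f t\<bar>) has_integral I) {0..pi}"
       "((\<lambda>t. w t * (f t)\<^sup>2) has_integral J) {0..pi}"
    unfolding W_def I_def J_def
    by (intro integrable_integral integrable_continuous_real continuous_intros)+
  have "((\<lambda>t. W\<^sup>2 * (w t * (f t)\<^sup>2) - 2 * W * I * (w t * \<bar>f t\<bar>) + I\<^sup>2 * w t)
     has_integral (W\<^sup>2 * J - 2 * W * I * I + I\<^sup>2 * W)) {0..pi}"
    by (intro has_integral_add has_integral_diff has_integral_mult_right int)
  moreover have "W\<^sup>2 * (w t * (f t)\<^sup>2) - 2 * W * I * (w t * \<bar>f t\<bar>) + I\<^sup>2 * w t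
      = w t * (W * \<bar>f t\<bar> - I)\<^sup>2" for t
    unfolding power2_diff power_mult_distrib power2_abs by (simp add: algebra_simps)
  ultimately have "((\<lambda>t. w t * (W * \<bar>f t\<bar> - I)\<^sup>2) has_integral (W\<^sup>2 * J - 2 * W * I * I + I\<^sup>2 * W)) {0..pi}"
    by (simp only:)
  then have "0 \<le> W\<^sup>2 * J - 2 * W * I * I + I\<^sup>2 * W"
    by (rule has_integral_nonneg) (use w_pos in \<open>auto simp: less_imp_le\<close>)
  also have "\<dots> = W * (W * J - I\<^sup>2)"
    by (simp add: power2_eq_square algebra_simps)
  finally have "0 \<le> W * (W * J - I\<^sup>2)" .
  moreover have "W > 0"
    using integral_less[of 0 pi "\<lambda>_. 0" w] w_pos cont_w pi_gt_zero unfolding W_def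
    by (simp del: pi_gt_zero)
  ultimately show ?thesis
    by (simp add: zero_le_mult_iff W_def I_def J_def)
qed

lemma weighted_L1_tendsto_0:
  fixes f :: "nat \<Rightarrow> real \<Rightarrow> real"
  assumes f: "\<And>n S. continuous_on S (f n)"
    and lim: "(\<lambda>n. integral {0..pi} (\<lambda>t. w t * (f n t)\<^sup>2)) \<longlonglongrightarrow> 0"
  shows "(\<lambda>n. integral {0..pi} (\<lambda>t. w t * \<bar>f n t\<bar>)) \<longlonglongrightarrow> 0"
proof -
  have "(\<lambda>n. integral {0..pi} w * integral {0..pi} (\<lambda>t. w t * (f n t)\<^sup>2)) \<longlonglongrightarrow> 0"
    using tendsto_mult_right_zero[OF lim] by blast
  then have "(\<lambda>n. (integral {0..pi} (\<lambda>t. w t * \<bar>f n t\<bar>))\<^sup>2) \<longlonglongrightarrow> 0"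
    by (rule tendsto_zero_squeeze) (use weighted_cauchy_schwarz[OF f] in auto)
  then show ?thesis
    by (simp add: power_tendsto_0_iff)
qed

text \<open>Antiperiodicity leaves no free constant of integration, so a mean bound on the
  derivative bounds the function everywhere.\<close>

lemma antiperiodic_bound_by_integral:
  fixes f g :: "real \<Rightarrow> real"
  assumes g: "\<And>t. (g has_real_derivative f t) (at t)" "\<And>t. g (t + pi) = - g t"
    and f: "\<And>S. continuous_on S f" "\<And>t. f (t + pi) = - f t"
  shows "\<bar>g t\<bar> \<le> integral {0..pi} (\<lambda>t. \<bar>f t\<bar>) / 2"
proof -
  have "g t = - (1/2) *\<^sub>R integral {t..t+pi} f"
    by (rule antiperiodic_eq_integral)
       (use g in \<open>auto simp: has_real_derivative_iff_has_vector_derivative\<close>)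
  then have "\<bar>g t\<bar> = \<bar>integral {t..t+pi} f\<bar> / 2"
    by (simp add: abs_mult)
  also have "\<bar>integral {t..t+pi} f\<bar> \<le> integral {t..t+pi} (\<lambda>t. \<bar>f t\<bar>)"
    using integral_norm_bound_integral[of f "{t..t+pi}" "\<lambda>t. \<bar>f t\<bar>"]
    by (auto intro!: integrable_continuous_real continuous_intros f)
  also have "\<dots> = integral {0..pi} (\<lambda>t. \<bar>f t\<bar>)"
    by (rule integral_periodic_shift) (auto intro!: continuous_intros f simp: f(2))
  finally show ?thesis by simp
qed

end

text \<open>The scalar system for the coordinates of a fixed point minus the iterated curves. The
  equation for \<open>Y\<close> starts at index 1, since \<open>Y 0\<close> comes from the initial
  curve. \<open>orth\<close> excludes the stationary solutions \<open>X = [Z, v]\<close>,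
  \<open>Y = [u, Z]\<close> with a constant \<open>Z \<noteq> 0\<close>.\<close>

locale frame_iteration = frame +
  fixes X Y :: "nat \<Rightarrow> real \<Rightarrow> real"
  assumes X_deriv: "\<And>n t. (X n has_real_derivative q t * Y n t) (at t)"
    and Y_deriv: "\<And>n t. (Y (Suc n) has_real_derivative - w t * X n t) (at t)"
    and X_anti [simp]: "\<And>n t. X n (t + pi) = - X n t"
    and Y_anti [simp]: "\<And>n t. Y n (t + pi) = - Y n t"
    and orth: "integral {0..pi} (\<lambda>t. (w t * X 0 t) *\<^sub>R v t) = 0"
begin

lemma cont_X [continuous_intros]: "continuous_on S (X n)"
  by (rule continuous_at_imp_continuous_on) (blast intro: DERIV_isCont X_deriv)

lemma cont_Y [continuous_intros]: "continuous_on S (Y (Suc n))"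
  by (rule continuous_at_imp_continuous_on) (blast intro: DERIV_isCont Y_deriv)

text \<open>The vector \<open>X u\<close> is \<pi>-periodic, so its derivative
  \<open>q Y u + w X v\<close> integrates to 0. Together with the same argument for
  \<open>Y v\<close> this passes orthogonality along the iteration.\<close>

lemma X_orth_step:
  "integral {0..pi} (\<lambda>t. (w t * X (Suc n) t) *\<^sub>R v t) = - integral {0..pi} (\<lambda>t. (q t * Y (Suc n) t) *\<^sub>R u t)"
proof -
  have "((\<lambda>t. (w t * X (Suc n) t) *\<^sub>R v t + (q t * Y (Suc n) t) *\<^sub>R u t) has_integral 0) {0..pi}"
    by (rule has_integral_derivative_periodic[where h = "\<lambda>t. X (Suc n) t *\<^sub>R u t"])
       (auto simp: mult.commute intro!: has_vector_derivative_eq_rhs[OF has_vector_derivative_scaleR[OF X_deriv u_deriv]])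
  then have "integral {0..pi} (\<lambda>t. (w t * X (Suc n) t) *\<^sub>R v t + (q t * Y (Suc n) t) *\<^sub>R u t) = 0"
    by (rule integral_unique)
  moreover have "integral {0..pi} (\<lambda>t. (w t * X (Suc n) t) *\<^sub>R v t + (q t * Y (Suc n) t) *\<^sub>R u t)
     = integral {0..pi} (\<lambda>t. (w t * X (Suc n) t) *\<^sub>R v t) + integral {0..pi} (\<lambda>t. (q t * Y (Suc n) t) *\<^sub>R u t)"
    by (intro integral_add integrable_continuous_real continuous_intros)
  ultimately show ?thesis
    by (simp add: eq_neg_iff_add_eq_0)
qed

lemma Y_orth_step:
  "integral {0..pi} (\<lambda>t. (q t * Y (Suc n) t) *\<^sub>R u t) = - integral {0..pi} (\<lambda>t. (w t * X n t) *\<^sub>R v t)"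
proof -
  have "((\<lambda>t. - ((q t * Y (Suc n) t) *\<^sub>R u t + (w t * X n t) *\<^sub>R v t)) has_integral 0) {0..pi}"
    by (rule has_integral_derivative_periodic[where h = "\<lambda>t. Y (Suc n) t *\<^sub>R v t"])
       (auto simp: mult.commute intro!: has_vector_derivative_eq_rhs[OF has_vector_derivative_scaleR[OF Y_deriv v_deriv]])
  then have "integral {0..pi} (\<lambda>t. (q t * Y (Suc n) t) *\<^sub>R u t + (w t * X n t) *\<^sub>R v t) = 0"
    unfolding has_integral_neg_iff minus_zero by (rule integral_unique)
  moreover have "integral {0..pi} (\<lambda>t. (q t * Y (Suc n) t) *\<^sub>R u t + (w t * X n t) *\<^sub>R v t)
     = integral {0..pi} (\<lambda>t. (q t * Y (Suc n) t) *\<^sub>R u t) + integral {0..pi} (\<lambda>t. (w t * X n t) *\<^sub>R v t)"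
    by (intro integral_add integrable_continuous_real continuous_intros)
  ultimately show ?thesis
    by (simp add: eq_neg_iff_add_eq_0)
qed

lemma X_orth: "integral {0..pi} (\<lambda>t. (w t * X n t) *\<^sub>R v t) = 0"
  by (induction n) (simp_all add: orth X_orth_step Y_orth_step)

lemma Y_orth: "integral {0..pi} (\<lambda>t. (q t * Y (Suc n) t) *\<^sub>R u t) = 0"
  by (simp add: Y_orth_step X_orth)

definition ip :: "nat \<Rightarrow> nat \<Rightarrow> real" where
  "ip m n = integral {0..pi} (\<lambda>t. w t * X m t * X n t)"

lemma has_integral_ip: "((\<lambda>t. w t * X m t * X n t) has_integral ip m n) {0..pi}"
  unfolding ip_def by (intro integrable_integral integrable_continuous_real continuous_intros)

text \<open>Integration by parts, applied to the periodic product of \<open>Y (Suc m)\<close> and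
  \<open>X (Suc n)\<close>.\<close>

lemma ip_Suc_right:
  "ip m (Suc n) = integral {0..pi} (\<lambda>t. q t * Y (Suc m) t * Y (Suc n) t)"
proof -
  let ?I = "integral {0..pi} (\<lambda>t. q t * Y (Suc m) t * Y (Suc n) t)"
  have "((\<lambda>t. q t * Y (Suc m) t * Y (Suc n) t - w t * X m t * X (Suc n) t) has_integral 0) {0..pi}"
    by (rule has_integral_derivative_periodic[where h = "\<lambda>t. Y (Suc m) t * X (Suc n) t"])
       (auto simp: algebra_simps simp flip: has_real_derivative_iff_has_vector_derivative
         intro!: derivative_eq_intros X_deriv Y_deriv)
  moreover have "((\<lambda>t. q t * Y (Suc m) t * Y (Suc n) t - w t * X m t * X (Suc n) t)
      has_integral (?I - ip m (Suc n))) {0..pi}"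
    by (intro has_integral_diff has_integral_ip integrable_integral integrable_continuous_real
              continuous_intros)
  ultimately have "0 = ?I - ip m (Suc n)"
    by (rule has_integral_unique)
  then show ?thesis
    by simp
qed

lemma ip_nonneg: "0 \<le> ip n n"
  using has_integral_ip by (rule has_integral_nonneg) (use w_pos in \<open>auto simp: less_imp_le mult.assoc\<close>)

lemma has_integral_X_diff:
  "((\<lambda>t. w t * (X (Suc n) t - X n t)\<^sup>2) has_integral
     (ip (Suc n) (Suc n) - 2 * ip n (Suc n) + ip n n)) {0..pi}"
proof -
  have "((\<lambda>t. w t * X (Suc n) t * X (Suc n) t - 2 * (w t * X n t * X (Suc n) t) + w t * X n t * X n t)
    has_integral (ip (Suc n) (Suc n) - 2 * ip n (Suc n) + ip n n)) {0..pi}"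
    by (intro has_integral_add has_integral_diff has_integral_mult_right has_integral_ip)
  then show ?thesis
    by (simp add: power2_eq_square algebra_simps)
qed

text \<open>By parts, the mixed number \<open>ip n (Suc n)\<close> is the right-hand side of the
  Wirtinger inequality for \<open>X (Suc n)\<close>. The second bound then follows because the mean
  square of \<open>X (Suc n) - X n\<close> is nonnegative.\<close>

lemma ip_decreasing: "ip (Suc n) (Suc n) \<le> ip n (Suc n)" "ip n (Suc n) \<le> ip n n"
proof -
  have "integral {0..pi} (\<lambda>t. w t * (X (Suc n) t)\<^sup>2) \<le> integral {0..pi} (\<lambda>t. q t * (Y (Suc n) t)\<^sup>2)"
    by (rule wirtinger) (auto intro: X_deriv cont_Y)
  then show 1: "ip (Suc n) (Suc n) \<le> ip n (Suc n)"
    by (simp add: ip_Suc_right[of n n] ip_def[of "Suc n" "Suc n"] power2_eq_square mult.assoc)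
  have "0 \<le> ip (Suc n) (Suc n) - 2 * ip n (Suc n) + ip n n"
    using has_integral_X_diff by (rule has_integral_nonneg) (use w_pos in \<open>auto simp: less_imp_le\<close>)
  with 1 show "ip n (Suc n) \<le> ip n n"
    by simp
qed

text \<open>The diagonal numbers decrease to a limit \<open>L\<close> and squeeze the mixed ones to
  the same \<open>L\<close>, so the mean square of the difference tends to
  \<open>L - 2 L + L\<close>.\<close>

lemma X_diff_tendsto_0:
  "(\<lambda>n. integral {0..pi} (\<lambda>t. w t * \<bar>X (Suc n) t - X n t\<bar>)) \<longlonglongrightarrow> 0"
proof (rule weighted_L1_tendsto_0)
  have "decseq (\<lambda>n. ip n n)"
    using ip_decreasing by (intro decseq_SucI) (meson order_trans)
  then obtain L where L: "(\<lambda>n. ip n n) \<longlonglongrightarrow> L"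
    using decseq_convergent[of "\<lambda>n. ip n n" 0] ip_nonneg by blast
  have "(\<lambda>n. ip (Suc n) (Suc n)) \<longlonglongrightarrow> L"
    using LIMSEQ_Suc[OF L] .
  moreover from this L have "(\<lambda>n. ip n (Suc n)) \<longlonglongrightarrow> L"
    by (rule tendsto_sandwich[rotated 2]) (auto simp: ip_decreasing)
  ultimately have "(\<lambda>n. ip (Suc n) (Suc n) - 2 * ip n (Suc n) + ip n n) \<longlonglongrightarrow> L - 2 * L + L"
    using L by (intro tendsto_intros)
  then show "(\<lambda>n. integral {0..pi} (\<lambda>t. w t * (X (Suc n) t - X n t)\<^sup>2)) \<longlonglongrightarrow> 0"
    by (simp add: integral_unique[OF has_integral_X_diff])
qed (intro continuous_intros)

text \<open>
  The vector \<open>X u + Y v\<close> has derivative \<open>w (X (Suc n) - X n) v\<close>, hence is nearly constant for large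
  \<open>n\<close>, so that \<open>X\<close> is close to a function \<open>[Z, v]\<close>, to which it is orthogonal.
\<close>
lemma ip_tendsto_0: "(\<lambda>n. ip (Suc n) (Suc n)) \<longlonglongrightarrow> 0"
proof -
  obtain V where V: "V > 0" "\<And>t. t \<in> {0..pi} \<Longrightarrow> norm (v t) \<le> V"
    using compact_imp_bounded[OF compact_continuous_image[OF cont_v compact_Icc], of 0 pi]
    by (auto simp: bounded_pos)
  obtain C where C: "C > 0" "\<And>a b. \<bar>bracket a b\<bar> \<le> norm a * norm b * C"
    using bracket.pos_bounded by auto
  define \<delta> where "\<delta> = (\<lambda>n. integral {0..pi} (\<lambda>t. w t * \<bar>X (Suc n) t - X n t\<bar>))"
  have \<delta>_nonneg: "\<delta> n \<ge> 0" for n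
    unfolding \<delta>_def by (intro integral_nonneg integrable_continuous_real continuous_intros)
      (use w_pos in \<open>auto simp: less_imp_le\<close>)
  have bound: "ip (Suc n) (Suc n) \<le> integral {0..pi} w * (V * V * C * \<delta> n)\<^sup>2" for n
  proof -
    \<comment> \<open>In its derivative the terms \<open>q Y u\<close> cancel, which leaves only the
      difference of consecutive \<open>X\<close>.\<close>
    define Z where "Z = (\<lambda>t. X (Suc n) t *\<^sub>R u t + Y (Suc n) t *\<^sub>R v t)"
    have Z: "(Z has_vector_derivative (w t * (X (Suc n) t - X n t)) *\<^sub>R v t) (at t)" for t
      unfolding Z_def
      by (rule has_vector_derivative_eq_rhs[OF has_vector_derivative_add[OF
            has_vector_derivative_scaleR[OF X_deriv u_deriv] has_vector_derivative_scaleR[OF Y_deriv v_deriv]]])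
         (simp add: algebra_simps)
    have "norm (Z t - Z 0) \<le> V * \<delta> n" if t: "t \<in> {0..pi}" for t
    proof -
      have "((\<lambda>t. (w t * (X (Suc n) t - X n t)) *\<^sub>R v t) has_integral (Z t - Z 0)) {0..t}"
        by (rule fundamental_theorem_of_calculus) (use t Z in \<open>auto simp: has_vector_derivative_at_within\<close>)
      then have "Z t - Z 0 = integral {0..t} (\<lambda>t. (w t * (X (Suc n) t - X n t)) *\<^sub>R v t)"
        by (simp add: integral_unique)
      also have "norm \<dots> \<le> integral {0..t} (\<lambda>t. V * (w t * \<bar>X (Suc n) t - X n t\<bar>))"
      proof (intro integral_norm_bound_integral integrable_continuous_real continuous_intros)
        fix s assume "s \<in> {0..t}"
        then have "norm (v s) \<le> V" using V(2)[of s] t by auto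
        then show "norm ((w s * (X (Suc n) s - X n s)) *\<^sub>R v s) \<le> V * (w s * \<bar>X (Suc n) s - X n s\<bar>)"
          using w_pos[of s] by (simp add: abs_mult mult.commute[of V] mult_left_mono)
      qed
      also have "\<dots> \<le> integral {0..pi} (\<lambda>t. V * (w t * \<bar>X (Suc n) t - X n t\<bar>))"
        by (intro integral_subset_le integrable_continuous_real continuous_intros)
           (use t V w_pos in \<open>auto simp: less_imp_le\<close>)
      also have "\<dots> = V * \<delta> n"
        by (simp add: \<delta>_def)
      finally show ?thesis .
    qed
    then have near: "\<bar>X (Suc n) t - bracket (Z 0) (v t)\<bar> \<le> V * V * C * \<delta> n" if t: "t \<in> {0..pi}" for t
    proof -
      have "X (Suc n) t - bracket (Z 0) (v t) = bracket (Z t - Z 0) (v t)"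
        by (simp add: Z_def bracket.diff_left bracket.add_left bracket.scaleR_left)
      also have "\<bar>\<dots>\<bar> \<le> norm (Z t - Z 0) * norm (v t) * C"
        by (rule C)
      also have "\<dots> \<le> (V * \<delta> n) * V * C"
        using \<open>t \<in> {0..pi} \<Longrightarrow> norm (Z t - Z 0) \<le> V * \<delta> n\<close> V C t \<delta>_nonneg
        by (intro mult_mono) auto
      finally show ?thesis by (simp add: mult_ac)
    qed
    have cross: "((\<lambda>t. w t * X (Suc n) t * bracket (Z 0) (v t)) has_integral 0) {0..pi}"
    proof -
      have "(\<lambda>t. (w t * X (Suc n) t) *\<^sub>R v t) integrable_on {0..pi}"
        by (intro integrable_continuous_real continuous_intros)
      from integrable_integral[OF this]
      have "((\<lambda>t. (w t * X (Suc n) t) *\<^sub>R v t) has_integral 0) {0..pi}"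
        by (simp only: X_orth)
      from has_integral_linear[OF this bracket.bounded_linear_right[of "Z 0"]] show ?thesis
        by (simp add: o_def bracket.scaleR_right bracket.zero_right)
    qed
    \<comment> \<open>Subtracting the cross term twice does not change the integral, but makes the
      integrand at most \<open>w (X - [Z 0, v])\<^sup>2\<close>, from which it differs by
      \<open>w [Z 0, v]\<^sup>2\<close>.\<close>
    have "((\<lambda>t. w t * X (Suc n) t * X (Suc n) t - 2 * (w t * X (Suc n) t * bracket (Z 0) (v t)))
        has_integral (ip (Suc n) (Suc n) - 2 * 0)) {0..pi}"
      by (intro has_integral_diff has_integral_mult_right has_integral_ip cross)
    moreover have "((\<lambda>t. w t * (V * V * C * \<delta> n)\<^sup>2) has_integral
        (integral {0..pi} w * (V * V * C * \<delta> n)\<^sup>2)) {0..pi}"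
      by (intro has_integral_mult_left integrable_integral integrable_continuous_real cont_w)
    ultimately have "ip (Suc n) (Suc n) - 2 * 0 \<le> integral {0..pi} w * (V * V * C * \<delta> n)\<^sup>2"
    proof (rule has_integral_le)
      fix t assume "t \<in> {0..pi}"
      then have "(X (Suc n) t - bracket (Z 0) (v t))\<^sup>2 \<le> (V * V * C * \<delta> n)\<^sup>2"
        using near[of t] by (intro power2_le_iff_abs_le[THEN iffD2] ) (use V C \<delta>_nonneg in auto)
      then have "X (Suc n) t * X (Suc n) t - 2 * (X (Suc n) t * bracket (Z 0) (v t)) \<le> (V * V * C * \<delta> n)\<^sup>2"
        unfolding power2_diff using zero_le_power2[of "bracket (Z 0) (v t)"]
        unfolding power2_eq_square mult.assoc by linarith
      from mult_left_mono[OF this less_imp_le[OF w_pos[of t]]]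
      show "w t * X (Suc n) t * X (Suc n) t - 2 * (w t * X (Suc n) t * bracket (Z 0) (v t))
             \<le> w t * (V * V * C * \<delta> n)\<^sup>2"
        by (simp add: algebra_simps)
    qed
    then show ?thesis by simp
  qed
  have "(\<lambda>n. integral {0..pi} w * (V * V * C * \<delta> n)\<^sup>2) \<longlonglongrightarrow> integral {0..pi} w * (V * V * C * 0)\<^sup>2"
    unfolding \<delta>_def by (intro tendsto_intros X_diff_tendsto_0)
  then show ?thesis
    by (intro tendsto_zero_squeeze[OF _ ip_nonneg bound]) simp
qed

text \<open>Mean convergence of \<open>X\<close> bounds the next \<open>Y\<close> uniformly through
  \<open>Y' = - w X\<close>, and this bounds \<open>X\<close> uniformly through
  \<open>X' = q Y\<close>. One index shift comes from this step, the other from the sequence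
  \<open>ip (Suc n) (Suc n)\<close>.\<close>

lemma uniform_limit_Y: "uniform_limit UNIV Y (\<lambda>_. 0) sequentially"
  and uniform_limit_X: "uniform_limit UNIV X (\<lambda>_. 0) sequentially"
proof -
  define \<delta> where "\<delta> = (\<lambda>n. integral {0..pi} (\<lambda>t. w t * \<bar>X (Suc n) t\<bar>))"
  have "\<delta> \<longlonglongrightarrow> 0"
    unfolding \<delta>_def
    by (rule weighted_L1_tendsto_0[OF cont_X])
       (use ip_tendsto_0 in \<open>simp add: ip_def power2_eq_square mult.assoc\<close>)
  have Y: "\<bar>Y (Suc (Suc n)) t\<bar> \<le> \<delta> n / 2" for n t
  proof -
    have "\<bar>Y (Suc (Suc n)) t\<bar> \<le> integral {0..pi} (\<lambda>t. \<bar>- w t * X (Suc n) t\<bar>) / 2"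
      by (rule antiperiodic_bound_by_integral[OF Y_deriv]) (auto intro!: continuous_intros)
    then show ?thesis
      by (simp add: \<delta>_def abs_mult abs_of_pos[OF w_pos])
  qed
  have X: "\<bar>X (Suc (Suc n)) t\<bar> \<le> integral {0..pi} q * (\<delta> n / 2) / 2" for n t
  proof -
    have "\<bar>X (Suc (Suc n)) t\<bar> \<le> integral {0..pi} (\<lambda>t. \<bar>q t * Y (Suc (Suc n)) t\<bar>) / 2"
      by (rule antiperiodic_bound_by_integral[OF X_deriv]) (auto intro!: continuous_intros)
    also have "integral {0..pi} (\<lambda>t. \<bar>q t * Y (Suc (Suc n)) t\<bar>) \<le> integral {0..pi} (\<lambda>t. q t * (\<delta> n / 2))"
      by (intro integral_le integrable_continuous_real continuous_intros)
         (use q_pos Y in \<open>auto simp: abs_mult less_imp_le\<close>)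
    finally show ?thesis by simp
  qed
  have lim: "uniform_limit UNIV F (\<lambda>_. 0) sequentially"
    if F: "\<And>n t. \<bar>F (Suc (Suc n)) t\<bar> \<le> c * \<delta> n" for F :: "nat \<Rightarrow> real \<Rightarrow> real" and c
  proof -
    have "(\<lambda>n. c * \<delta> n) \<longlonglongrightarrow> 0"
      using tendsto_mult_right_zero[OF \<open>\<delta> \<longlonglongrightarrow> 0\<close>] by blast
    then have "\<forall>\<^sub>F n in sequentially. c * \<delta> n < e" if "e > 0" for e
      using that by (rule order_tendstoD)
    then have "uniform_limit UNIV (\<lambda>n. F (Suc (Suc n))) (\<lambda>_. 0) sequentially"
      unfolding uniform_limit_iff using F
      by (fastforce elim!: eventually_mono intro: le_less_trans)
    then show ?thesis
      unfolding uniform_limit_iff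
      using eventually_sequentially_Suc[of "\<lambda>n. \<forall>x\<in>UNIV. dist (F n x) 0 < _"]
        eventually_sequentially_Suc[of "\<lambda>n. \<forall>x\<in>UNIV. dist (F (Suc n) x) 0 < _"] by simp
  qed
  show "uniform_limit UNIV Y (\<lambda>_. 0) sequentially"
    by (rule lim[of _ "1/2"]) (use Y in simp)
  show "uniform_limit UNIV X (\<lambda>_. 0) sequentially"
    by (rule lim[of _ "integral {0..pi} q / 4"]) (use X in simp)
qed

end

section \<open>Smooth families\<close>

text \<open>Uniform in the index as well as in the parameter: factors of this kind preserve uniform
  convergence to 0.\<close>

definition unif_bdd :: "(nat \<Rightarrow> real \<Rightarrow> 'a::real_normed_vector) \<Rightarrow> bool" where
  "unif_bdd F \<longleftrightarrow> (\<exists>B. \<forall>i t. norm (F i t) \<le> B)"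

definition unif_null :: "(nat \<Rightarrow> real \<Rightarrow> 'a::real_normed_vector) \<Rightarrow> bool" where
  "unif_null F \<longleftrightarrow> uniform_limit UNIV F (\<lambda>_. 0) sequentially"

lemma unif_bdd_add: "unif_bdd F \<Longrightarrow> unif_bdd G \<Longrightarrow> unif_bdd (\<lambda>i t. F i t + G i t)"
  unfolding unif_bdd_def by (meson norm_triangle_mono)

lemma unif_null_add: "unif_null F \<Longrightarrow> unif_null G \<Longrightarrow> unif_null (\<lambda>i t. F i t + G i t)"
  unfolding unif_null_def by (drule (1) uniform_limit_add) simp

lemma (in bounded_bilinear) unif_bdd_prod:
  assumes "unif_bdd F" "unif_bdd G"
  shows "unif_bdd (\<lambda>i t. prod (F i t) (G i t))"
proof -
  obtain A B K where A: "\<And>i t. norm (F i t) \<le> A" and B: "\<And>i t. norm (G i t) \<le> B"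
    and K: "\<And>a b. norm (prod a b) \<le> norm a * norm b * K" "K \<ge> 0"
    using assms nonneg_bounded by (auto simp: unif_bdd_def)
  have "norm (prod (F i t) (G i t)) \<le> A * B * K" for i t
    using order_trans[OF norm_ge_zero A[of i t]]
    by (intro order_trans[OF K(1)] mult_right_mono mult_mono A B K(2)) auto
  then show ?thesis
    unfolding unif_bdd_def by blast
qed

lemma (in bounded_bilinear) unif_null_prod:
  assumes "unif_bdd F" "unif_null G"
  shows "unif_null (\<lambda>i t. prod (F i t) (G i t))"
  unfolding unif_null_def uniform_limit_iff
proof (intro allI impI)
  fix e :: real assume "e > 0"
  obtain A K where A: "\<And>i t. norm (F i t) \<le> A"
    and K: "\<And>a b. norm (prod a b) \<le> norm a * norm b * K" "K > 0"
    using assms(1) pos_bounded by (auto simp: unif_bdd_def)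
  have "A \<ge> 0"
    using order_trans[OF norm_ge_zero A] .
  \<comment> \<open>\<open>A + 1\<close> instead of \<open>A\<close> keeps the divisor positive when
    \<open>A = 0\<close>.\<close>
  define d where "d = e / ((A + 1) * K)"
  have "d > 0"
    using \<open>e > 0\<close> \<open>A \<ge> 0\<close> K(2) by (simp add: d_def)
  have "\<forall>\<^sub>F i in sequentially. \<forall>t\<in>UNIV. dist (G i t) 0 < d"
    using assms(2) \<open>d > 0\<close> unfolding unif_null_def uniform_limit_iff by blast
  then show "\<forall>\<^sub>F i in sequentially. \<forall>t\<in>UNIV. dist (prod (F i t) (G i t)) 0 < e"
  proof (rule eventually_mono)
    fix i assume G: "\<forall>t\<in>UNIV. dist (G i t) 0 < d"
    show "\<forall>t\<in>UNIV. dist (prod (F i t) (G i t)) 0 < e"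
    proof
      fix t
      have "norm (prod (F i t) (G i t)) \<le> norm (F i t) * norm (G i t) * K"
        by (rule K(1))
      also have "\<dots> \<le> (A + 1) * norm (G i t) * K"
        using A[of i t] K(2) by (intro mult_right_mono) auto
      also have "\<dots> < (A + 1) * d * K"
        using G \<open>A \<ge> 0\<close> K(2) by (intro mult_strict_right_mono mult_strict_left_mono) auto
      also have "\<dots> = e"
        using \<open>A \<ge> 0\<close> K(2) by (simp add: d_def)
      finally show "dist (prod (F i t) (G i t)) 0 < e" by simp
    qed
  qed
qed

text \<open>Constant families describe single functions.\<close>
primrec derivs_in ::
  "((nat \<Rightarrow> real \<Rightarrow> 'a::real_normed_vector) \<Rightarrow> bool) \<Rightarrow> nat \<Rightarrow> (nat \<Rightarrow> real \<Rightarrow> 'a) \<Rightarrow> bool" where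
  "derivs_in S 0 F \<longleftrightarrow> S F"
| "derivs_in S (Suc n) F \<longleftrightarrow>
     S F \<and> (\<exists>G. (\<forall>i t. (F i has_vector_derivative G i t) (at t)) \<and> derivs_in S n G)"

lemma derivs_in_base: "derivs_in S n F \<Longrightarrow> S F"
  by (cases n) auto

lemma derivs_in_SucD: "derivs_in S (Suc n) F \<Longrightarrow> derivs_in S n F"
  by (induction n arbitrary: F) auto

lemma derivs_in_add:
  assumes "\<And>F G. S F \<Longrightarrow> S G \<Longrightarrow> S (\<lambda>i t. F i t + G i t)"
  shows "derivs_in S n F \<Longrightarrow> derivs_in S n G \<Longrightarrow> derivs_in S n (\<lambda>i t. F i t + G i t)"
proof (induction n arbitrary: F G)
  case (Suc n)
  then obtain F' G' where "\<And>i t. (F i has_vector_derivative F' i t) (at t)" "derivs_in S n F'"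
    "\<And>i t. (G i has_vector_derivative G' i t) (at t)" "derivs_in S n G'" "S F" "S G"
    by auto
  then show ?case
    using Suc.IH[of F' G'] by (auto intro!: assms exI[of _ "\<lambda>i t. F' i t + G' i t"] has_vector_derivative_add)
qed (use assms in simp)

text \<open>Leibniz's rule, stated for abstract classes of families so that one induction serves
  both bounded and null families.\<close>

lemma (in bounded_bilinear) derivs_in_prod_aux:
  assumes add: "\<And>F G. S F \<Longrightarrow> S G \<Longrightarrow> S (\<lambda>i t. F i t + G i t)"
    and prod: "\<And>F G. unif_bdd F \<Longrightarrow> S' G \<Longrightarrow> S (\<lambda>i t. prod (F i t) (G i t))"
  shows "derivs_in unif_bdd n F \<Longrightarrow> derivs_in S' n G \<Longrightarrow> derivs_in S n (\<lambda>i t. prod (F i t) (G i t))"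
proof (induction n arbitrary: F G)
  case (Suc n)
  then obtain F' G' where F': "\<And>i t. (F i has_vector_derivative F' i t) (at t)" "derivs_in unif_bdd n F'"
    and G': "\<And>i t. (G i has_vector_derivative G' i t) (at t)" "derivs_in S' n G'"
    and "unif_bdd F" "S' G"
    by auto
  have "derivs_in S n (\<lambda>i t. prod (F i t) (G' i t) + prod (F' i t) (G i t))"
    using Suc.IH[OF derivs_in_SucD[OF Suc.prems(1)] G'(2)] Suc.IH[OF F'(2) derivs_in_SucD[OF Suc.prems(2)]]
    by (rule derivs_in_add[rotated]) (erule (1) add)
  then show ?case
    using has_vector_derivative[OF F'(1) G'(1)] prod \<open>unif_bdd F\<close> \<open>S' G\<close>
    by (auto intro!: exI[of _ "\<lambda>i t. prod (F i t) (G' i t) + prod (F' i t) (G i t)"])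
qed (use prod in simp)

lemma (in bounded_bilinear) derivs_in_bdd_prod:
  "derivs_in unif_bdd n F \<Longrightarrow> derivs_in unif_bdd n G \<Longrightarrow> derivs_in unif_bdd n (\<lambda>i t. prod (F i t) (G i t))"
  by (rule derivs_in_prod_aux[of unif_bdd unif_bdd]) (simp_all add: unif_bdd_add unif_bdd_prod)

lemma (in bounded_bilinear) derivs_in_null_prod:
  "derivs_in unif_bdd n F \<Longrightarrow> derivs_in unif_null n G \<Longrightarrow> derivs_in unif_null n (\<lambda>i t. prod (F i t) (G i t))"
  by (rule derivs_in_prod_aux[of unif_null unif_null]) (simp_all add: unif_null_add unif_null_prod)

text \<open>For periodic functions this is ordinary smoothness, since continuous periodic functions
  are bounded. The bounds admit such functions as factors of null families.\<close>

definition smoothb :: "(real \<Rightarrow> 'a::real_normed_vector) \<Rightarrow> bool" where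
  "smoothb f \<longleftrightarrow> (\<forall>n. derivs_in unif_bdd n (\<lambda>_. f))"

lemma smoothb_add: "smoothb f \<Longrightarrow> smoothb g \<Longrightarrow> smoothb (\<lambda>t. f t + g t)"
  by (simp add: smoothb_def derivs_in_add unif_bdd_add)

lemma (in bounded_bilinear) smoothb_prod: "smoothb f \<Longrightarrow> smoothb g \<Longrightarrow> smoothb (\<lambda>t. prod (f t) (g t))"
  by (simp add: smoothb_def derivs_in_bdd_prod)

lemma smoothb_const: "smoothb (\<lambda>t. c)"
proof -
  have "derivs_in unif_bdd n (\<lambda>i t. c)" for n
  proof (induction n arbitrary: c)
    case (Suc n)
    then show ?case
      by (auto simp: unif_bdd_def intro!: exI[of _ "\<lambda>i t. 0"])
  qed (auto simp: unif_bdd_def)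
  then show ?thesis by (simp add: smoothb_def)
qed

lemmas smoothb_scaleR = bounded_bilinear.smoothb_prod[OF bounded_bilinear_scaleR]
lemma smoothb_minus: "smoothb f \<Longrightarrow> smoothb (\<lambda>t. - f t)"
  using smoothb_scaleR[OF smoothb_const[of "-1"]] by simp

lemma smoothb_diff: "smoothb f \<Longrightarrow> smoothb g \<Longrightarrow> smoothb (\<lambda>t. f t - g t)"
  using smoothb_add[OF _ smoothb_minus] by simp

lemma smoothb_deriv:
  assumes f: "smoothb f" and f': "\<And>t. (f has_vector_derivative f' t) (at t)"
  shows "smoothb f'"
  unfolding smoothb_def
proof
  fix n
  obtain G where G: "\<And>i t. (f has_vector_derivative G i t) (at t)" "derivs_in unif_bdd n G"
    using f[unfolded smoothb_def, rule_format, of "Suc n"] by auto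
  have "G = (\<lambda>_. f')"
    using vector_derivative_unique_at[OF G(1) f'] by auto
  with G show "derivs_in unif_bdd n (\<lambda>_. f')" by simp
qed

lemma smoothb_imp_deriv:
  assumes "smoothb f"
  shows "(f has_vector_derivative vector_derivative f (at t)) (at t)"
  using assms[unfolded smoothb_def, rule_format, of "Suc 0"]
  by (auto simp: vector_derivative_works[symmetric] intro: differentiableI_vector)

lemma smoothb_D: "smoothb f \<Longrightarrow> (f has_vector_derivative D f t) (at t)" "smoothb f \<Longrightarrow> smoothb (D f)"
  using smoothb_imp_deriv smoothb_deriv[of f "D f"] by (auto simp: D_def)

lemma smoothb_continuous: "smoothb f \<Longrightarrow> continuous_on S f"
  by (rule continuous_at_imp_continuous_on) (blast intro: has_vector_derivative_continuous smoothb_imp_deriv)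

text \<open>The identity \<open>(1/f)' = - f' (1/f)\<^sup>2\<close> expresses each derivative of
  \<open>1/f\<close> through lower ones; the lower bound on \<open>f\<close> starts the induction by
  bounding \<open>1/f\<close>.\<close>

lemma smoothb_inverse:
  fixes f :: "real \<Rightarrow> real"
  assumes f: "smoothb f" and c: "c > 0" "\<And>t. f t \<ge> c"
  shows "smoothb (\<lambda>t. inverse (f t))"
proof -
  obtain f' where f': "\<And>t. (f has_vector_derivative f' t) (at t)"
    using that[OF smoothb_imp_deriv[OF f]] .
  have bdd: "unif_bdd (\<lambda>_ t. inverse (f t))"
    unfolding unif_bdd_def
  proof (intro exI allI)
    show "norm (inverse (f t)) \<le> inverse c" for t
      using c(1) c(2)[of t] by (simp add: le_imp_inverse_le)
  qed
  have "derivs_in unif_bdd n (\<lambda>_ t. inverse (f t))" for n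
  proof (induction n)
    case (Suc n)
    have "derivs_in unif_bdd n (\<lambda>_. \<lambda>t. - f' t)"
      using smoothb_minus[OF smoothb_deriv[OF f f']] by (simp add: smoothb_def)
    then have "derivs_in unif_bdd n (\<lambda>_ t. - f' t * (inverse (f t) * inverse (f t)))"
      by (intro bounded_bilinear.derivs_in_bdd_prod[OF bounded_bilinear_mult] Suc.IH)
    moreover have "((\<lambda>t. inverse (f t)) has_vector_derivative - f' t * (inverse (f t) * inverse (f t))) (at t)" for t
      using f'[of t] c(1) c(2)[of t]
      by (auto simp flip: has_real_derivative_iff_has_vector_derivative intro!: derivative_eq_intros)
    ultimately show ?case
      using bdd by (auto intro!: exI[of _ "\<lambda>_ t. - f' t * (inverse (f t) * inverse (f t))"])
  qed (use bdd in simp)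
  then show ?thesis by (simp add: smoothb_def)
qed

lemma smoothb_shift:
  assumes "smoothb f"
  shows "smoothb (\<lambda>t. f (t + a))"
proof -
  have "derivs_in unif_bdd n (\<lambda>i t. F i (t + a))" if "derivs_in unif_bdd n F"
    for n and F :: "nat \<Rightarrow> real \<Rightarrow> 'a"
    using that
  proof (induction n arbitrary: F)
    case (Suc n)
    then obtain G where G: "\<And>i t. (F i has_vector_derivative G i t) (at t)" "derivs_in unif_bdd n G"
      and "unif_bdd F"
      by auto
    have "((\<lambda>x. F i (x + a)) has_vector_derivative G i (t + a)) (at t)" for i t
      by (rule has_vector_derivative_shift[OF G(1)])
    moreover have "unif_bdd (\<lambda>i t. F i (t + a))"
      using \<open>unif_bdd F\<close> by (auto simp: unif_bdd_def)
    ultimately show ?case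
      using Suc.IH[OF G(2)] by (auto intro!: exI[of _ "\<lambda>i t. G i (t + a)"])
  qed (auto simp: unif_bdd_def)
  from this[of _ "\<lambda>_. f"] show ?thesis
    using assms by (simp add: smoothb_def)
qed

lemma D_periodic:
  assumes "\<And>t. f (t + a) = c *\<^sub>R f t" "\<And>t. f differentiable at t"
  shows "D f (t + a) = c *\<^sub>R D f t"
proof -
  have f: "(f has_vector_derivative D f t) (at t)" for t
    using assms(2) by (simp add: D_def vector_derivative_works)
  have "((\<lambda>t. f (t + a)) has_vector_derivative D f (t + a)) (at t)"
    by (rule has_vector_derivative_shift[OF f])
  moreover have "((\<lambda>t. f (t + a)) has_vector_derivative c *\<^sub>R D f t) (at t)"
    unfolding assms(1)
    by (rule bounded_linear.has_vector_derivative[OF bounded_linear_scaleR_right f])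
  ultimately show ?thesis
    by (rule vector_derivative_unique_at)
qed

lemma periodic_bounded:
  fixes f :: "real \<Rightarrow> 'a::real_normed_vector"
  assumes "continuous_on UNIV f" "\<And>t. f (t + a) = f t" "a > 0"
  shows "\<exists>B. \<forall>t. norm (f t) \<le> B"
proof -
  have shift: "f (t + of_int n * a) = f t" for t and n :: int
  proof (induction n rule: int_induct[of _ 0])
    case (step1 i)
    then show ?case using assms(2)[of "t + of_int i * a"] by (simp add: algebra_simps)
  next
    case (step2 i)
    then show ?case using assms(2)[of "t + of_int (i - 1) * a"] by (simp add: algebra_simps)
  qed simp
  have "bounded (f ` {0..a})"
    by (intro compact_imp_bounded compact_continuous_image continuous_on_subset[OF assms(1)]) auto
  then obtain B where B: "\<And>t. t \<in> {0..a} \<Longrightarrow> norm (f t) \<le> B"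
    unfolding bounded_iff by blast
  have "norm (f t) \<le> B" for t
  proof -
    have "t - of_int \<lfloor>t / a\<rfloor> * a \<in> {0..a}"
      using floor_divide_lower[OF assms(3), of t] floor_divide_upper[OF assms(3), of t]
      by (auto simp: algebra_simps)
    then show ?thesis
      using B[of "t - of_int \<lfloor>t / a\<rfloor> * a"] shift[of t "- \<lfloor>t / a\<rfloor>"] by simp
  qed
  then show ?thesis by blast
qed

section \<open>Passage between iterates of \<open>D\<close> and chains of derivatives\<close>

lemma smooth_curve_D: "smooth_curve f \<Longrightarrow> smooth_curve (D f)"
  unfolding smooth_curve_def using funpow_swap1 by (metis funpow.simps(2) o_apply)

lemma smooth_curve_has_derivative: "smooth_curve f \<Longrightarrow> (f has_vector_derivative D f t) (at t)"
  unfolding smooth_curve_def D_def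
  by (metis funpow_0 vector_derivative_works)

lemma smoothb_if_smooth_curve:
  assumes "smooth_curve f" "\<And>t. f (t + a) = f t" "a > 0"
  shows "smoothb f"
proof -
  have "derivs_in unif_bdd n (\<lambda>_. f)" for n
    using assms
  proof (induction n arbitrary: f)
    case 0
    have "continuous_on UNIV f"
      by (rule continuous_at_imp_continuous_on)
         (blast intro: has_vector_derivative_continuous smooth_curve_has_derivative 0)
    then show ?case
      using periodic_bounded[of f a] 0 by (simp add: unif_bdd_def)
  next
    case (Suc n)
    have diff: "(f has_vector_derivative D f t) (at t)" for t
      by (rule smooth_curve_has_derivative[OF Suc.prems(1)])
    have "continuous_on UNIV f"
      by (rule continuous_at_imp_continuous_on) (blast intro: has_vector_derivative_continuous diff)
    then have "unif_bdd (\<lambda>_::nat. f)"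
      using periodic_bounded[of f a] Suc.prems by (simp add: unif_bdd_def)
    moreover have "derivs_in unif_bdd n (\<lambda>_. D f)"
      using Suc.prems D_periodic[of f a 1] differentiableI_vector[OF diff]
      by (intro Suc.IH smooth_curve_D) auto
    ultimately show ?case
      using diff by (auto intro!: exI[of _ "\<lambda>_. D f"])
  qed
  then show ?thesis by (simp add: smoothb_def)
qed

text \<open>Turns the existentially given chain of derivatives into iterates of \<open>D\<close>;
  each link is identified by uniqueness of derivatives.\<close>

lemma derivs_in_D:
  assumes "derivs_in S n F"
  shows "k \<le> n \<Longrightarrow> S (\<lambda>i. (D ^^ k) (F i))" "k < n \<Longrightarrow> (D ^^ k) (F i) differentiable at t"
proof -
  have "(k \<le> n \<longrightarrow> S (\<lambda>i. (D ^^ k) (F i))) \<and> (k < n \<longrightarrow> (D ^^ k) (F i) differentiable at t)"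
    using assms
  proof (induction n arbitrary: F k)
    case (Suc n)
    then obtain G where G: "\<And>i t. (F i has_vector_derivative G i t) (at t)" "derivs_in S n G" and "S F"
      by auto
    have DF: "D (F i) = G i" for i
      using G(1) by (auto simp: D_def vector_derivative_at)
    show ?case
    proof (cases k)
      case 0
      then show ?thesis using \<open>S F\<close> G(1) by (auto intro: differentiableI_vector)
    next
      case (Suc k')
      then have "(D ^^ k) (F i) = (D ^^ k') (G i)" for i
        by (simp add: funpow_swap1 DF del: funpow.simps(2)) (simp add: funpow_swap1 DF)
      then show ?thesis using Suc.IH[OF G(2), of k'] Suc by simp
    qed
  qed simp
  then show "k \<le> n \<Longrightarrow> S (\<lambda>i. (D ^^ k) (F i))" "k < n \<Longrightarrow> (D ^^ k) (F i) differentiable at t"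
    by auto
qed

lemma smooth_curve_if_smoothb: "smoothb f \<Longrightarrow> smooth_curve f"
  unfolding smooth_curve_def smoothb_def using derivs_in_D(2) by blast

lemma funpow_D_add:
  assumes "smooth_curve f" "smooth_curve g"
  shows "(D ^^ n) (\<lambda>t. f t + g t) = (\<lambda>t. (D ^^ n) f t + (D ^^ n) g t)"
proof (induction n)
  case (Suc n)
  have "((\<lambda>t. (D ^^ n) f t + (D ^^ n) g t) has_vector_derivative
            D ((D ^^ n) f) t + D ((D ^^ n) g) t) (at t)" for t
    using assms unfolding smooth_curve_def D_def[of "(D ^^ n) _"]
    by (intro has_vector_derivative_add) (auto simp: vector_derivative_works)
  then show ?case
    by (auto simp: Suc D_def[of "\<lambda>t. (D ^^ n) f t + (D ^^ n) g t"] vector_derivative_at)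
qed simp

lemma smooth_curve_add: "smooth_curve f \<Longrightarrow> smooth_curve g \<Longrightarrow> smooth_curve (\<lambda>t. f t + g t)"
  unfolding smooth_curve_def by (simp add: funpow_D_add smooth_curve_def differentiable_add)

text \<open>\<open>F\<close> is the error; the derivatives of \<open>f\<close> split into those of
  \<open>F\<close> and \<open>g\<close> because both are smooth.\<close>

lemma converges_CinfI:
  assumes null: "\<And>n. derivs_in unif_null n F" and g: "smoothb g"
    and f: "\<And>i t. f i t = F i t + g t"
  shows "converges_Cinf f g"
proof -
  have F: "smooth_curve (F i)" for i
    unfolding smooth_curve_def using derivs_in_D(2)[OF null] by blast
  have g': "smooth_curve g"
    by (rule smooth_curve_if_smoothb[OF g])
  have f': "f = (\<lambda>i t. F i t + g t)"
    using f by auto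
  have "uniform_limit UNIV (\<lambda>i. (D ^^ n) (f i)) ((D ^^ n) g) sequentially" for n
  proof -
    have "uniform_limit UNIV (\<lambda>i. (D ^^ n) (F i)) (\<lambda>_. 0) sequentially"
      using derivs_in_D(1)[OF null[of n]] by (simp add: unif_null_def)
    from uniform_limit_add[OF this uniform_limit_const[of "(D ^^ n) g"]] show ?thesis
      by (simp add: f' funpow_D_add[OF F g'])
  qed
  then show ?thesis
    unfolding converges_Cinf_def using smooth_curve_add[OF F g'] g' by (simp add: f')
qed

lemma unif_null_Suc_iff: "unif_null (\<lambda>i. F (Suc i)) \<longleftrightarrow> unif_null F"
  unfolding unif_null_def uniform_limit_iff
  using eventually_sequentially_Suc[of "\<lambda>n. \<forall>x\<in>UNIV. dist (F n x) 0 < _"] by simp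

lemma derivs_in_null_Suc: "derivs_in unif_null n F \<Longrightarrow> derivs_in unif_null n (\<lambda>i. F (Suc i))"
proof (induction n arbitrary: F)
  case (Suc n)
  then obtain G where G: "\<And>i t. (F i has_vector_derivative G i t) (at t)" "derivs_in unif_null n G"
    by auto
  then show ?case
    using Suc.IH[OF G(2)] derivs_in_base[OF Suc.prems] unif_null_Suc_iff[of F]
    by (auto intro!: exI[of _ "\<lambda>i. G (Suc i)"])
qed (simp add: unif_null_Suc_iff)

text \<open>A limit ignores the first member, but its derivatives must still exist, hence the
  assumption on \<open>F 0\<close>. Intended for \<open>Y\<close>, whose recursion starts at index
  1.\<close>

lemma derivs_in_null_if_Suc:
  "derivs_in unif_bdd n (\<lambda>_. F 0) \<Longrightarrow> derivs_in unif_null n (\<lambda>i. F (Suc i)) \<Longrightarrow> derivs_in unif_null n F"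
proof (induction n arbitrary: F)
  case (Suc n)
  then obtain G where G: "\<And>i t. (F (Suc i) has_vector_derivative G i t) (at t)" "derivs_in unif_null n G"
    by auto
  obtain G0 where G0: "\<And>i t. (F 0 has_vector_derivative G0 i t) (at t)" "derivs_in unif_bdd n G0"
    using Suc.prems by auto
  have "G0 = (\<lambda>_. G0 0)"
    using vector_derivative_unique_at[OF G0(1) G0(1)] by blast
  then have "derivs_in unif_bdd n (\<lambda>_. G0 0)"
    using G0(2) by simp
  define H where "H = case_nat (G0 0) G"
  have "derivs_in unif_null n H"
    by (rule Suc.IH) (use \<open>derivs_in unif_bdd n (\<lambda>_. G0 0)\<close> G(2) in \<open>simp_all add: H_def\<close>)
  moreover have "(F i has_vector_derivative H i t) (at t)" for i t
    using G0(1) G(1) by (cases i) (auto simp: H_def)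
  ultimately show ?case
    using Suc.prems unif_null_Suc_iff[of F] by auto
qed (simp add: unif_null_Suc_iff)

section \<open>Iterated involutes\<close>

text \<open>By antiperiodicity the moving integral has derivative \<open>- 2 w \<alpha>\<close>, so
  \<open>\<beta>' v\<close> cancels the derivative of \<open>M\<close> and leaves that of
  \<open>N\<close> parallel to \<open>u\<close>.\<close>

lemma (in frame) involute_step:
  assumes \<alpha>: "\<And>S. continuous_on S \<alpha>" "\<And>t. \<alpha> (t + pi) = - \<alpha> t"
    and M: "\<And>t. M (t + pi) = M t" "\<And>t. (M has_vector_derivative (\<alpha> t * w t) *\<^sub>R v t) (at t)"
    and \<beta>: "\<And>t. \<beta> t = (1/2) * integral {t..t + pi} (\<lambda>s. \<alpha> s * w s)"
    and N: "\<And>t. N t = M t + \<beta> t *\<^sub>R v t"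
  shows "(\<beta> has_real_derivative - w t * \<alpha> t) (at t)" "\<beta> (t + pi) = - \<beta> t" "N (t + pi) = N t"
    "(N has_vector_derivative - (\<beta> t * q t) *\<^sub>R u t) (at t)"
proof -
  let ?f = "\<lambda>s. \<alpha> s * w s"
  have f: "continuous_on S ?f" for S
    by (intro continuous_intros \<alpha>)
  have "((\<lambda>t. integral {t..t + pi} ?f) has_real_derivative ?f (t + pi) - ?f t) (at t)"
    using has_vector_derivative_moving_integral[OF f, of pi t]
    by (simp add: has_real_derivative_iff_has_vector_derivative)
  from DERIV_cmult[OF this, of "1/2"] show D: "(\<beta> has_real_derivative - w t * \<alpha> t) (at t)"
    unfolding \<beta>[abs_def] by (simp add: \<alpha>(2) mult.commute)
  have "\<beta> (t + pi) = (1/2) * integral {t..t + pi} (?f \<circ> (+) pi)"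
    unfolding \<beta> integral_shift_Icc_real by simp
  also have "?f \<circ> (+) pi = (\<lambda>s. - ?f s)"
    using \<alpha>(2) w_per by (simp add: fun_eq_iff add.commute[of pi])
  finally show anti: "\<beta> (t + pi) = - \<beta> t"
    by (simp add: \<beta>)
  show "N (t + pi) = N t"
    by (simp add: N M anti)
  have "((\<lambda>t. M t + \<beta> t *\<^sub>R v t) has_vector_derivative
      (\<alpha> t * w t) *\<^sub>R v t + (\<beta> t *\<^sub>R (- q t *\<^sub>R u t) + (- w t * \<alpha> t) *\<^sub>R v t)) (at t)"
    by (intro has_vector_derivative_add has_vector_derivative_scaleR M v_deriv D)
  then show "(N has_vector_derivative - (\<beta> t * q t) *\<^sub>R u t) (at t)"
    unfolding N[abs_def] by (simp add: mult.commute)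
qed

locale iterated_involutes = frame +
  fixes M N :: "nat \<Rightarrow> real \<Rightarrow> real^2" and \<alpha> \<beta> :: "nat \<Rightarrow> real \<Rightarrow> real"
  assumes \<alpha>_0: "\<And>S. continuous_on S (\<alpha> 0)" "\<And>t. \<alpha> 0 (t + pi) = - \<alpha> 0 t"
    and M_0: "\<And>t. M 0 (t + pi) = M 0 t"
      "\<And>t. (M 0 has_vector_derivative (\<alpha> 0 t * w t) *\<^sub>R v t) (at t)"
    and \<beta>_Suc: "\<And>i t. \<beta> (Suc i) t = (1/2) * integral {t..t + pi} (\<lambda>s. \<alpha> i s * w s)"
    and N_Suc: "\<And>i t. N (Suc i) t = M i t + \<beta> (Suc i) t *\<^sub>R v t"
    and \<alpha>_Suc: "\<And>i t. \<alpha> (Suc i) t = - (1/2) * integral {t..t + pi} (\<lambda>s. \<beta> (Suc i) s * q s)"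
    and M_Suc: "\<And>i t. M (Suc i) t = N (Suc i) t + \<alpha> (Suc i) t *\<^sub>R u t"
begin

text \<open>Each integral formula yields a derivative only once the preceding coefficient is known
  to be continuous and antiperiodic, so all facts are carried through one induction.\<close>

lemma invariants:
  "(\<forall>S. continuous_on S (\<alpha> i)) \<and> (\<forall>t. \<alpha> i (t + pi) = - \<alpha> i t) \<and>
   (\<forall>t. M i (t + pi) = M i t) \<and> (\<forall>t. (M i has_vector_derivative (\<alpha> i t * w t) *\<^sub>R v t) (at t)) \<and>
   (\<forall>t. N (Suc i) (t + pi) = N (Suc i) t) \<and>
   (\<forall>t. (N (Suc i) has_vector_derivative - (\<beta> (Suc i) t * q t) *\<^sub>R u t) (at t))"
proof -
  have N_step: "(\<forall>S. continuous_on S (\<beta> (Suc i))) \<and> (\<forall>t. \<beta> (Suc i) (t + pi) = - \<beta> (Suc i) t) \<and>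
     (\<forall>t. N (Suc i) (t + pi) = N (Suc i) t) \<and>
     (\<forall>t. (N (Suc i) has_vector_derivative - (\<beta> (Suc i) t * q t) *\<^sub>R u t) (at t))"
    if "(\<forall>S. continuous_on S (\<alpha> i)) \<and> (\<forall>t. \<alpha> i (t + pi) = - \<alpha> i t) \<and>
      (\<forall>t. M i (t + pi) = M i t) \<and> (\<forall>t. (M i has_vector_derivative (\<alpha> i t * w t) *\<^sub>R v t) (at t))"
    for i
  proof -
    have "\<And>S. continuous_on S (\<alpha> i)" "\<And>t. \<alpha> i (t + pi) = - \<alpha> i t" "\<And>t. M i (t + pi) = M i t"
      "\<And>t. (M i has_vector_derivative (\<alpha> i t * w t) *\<^sub>R v t) (at t)"
      using that by auto
    note step = involute_step[OF this \<beta>_Suc N_Suc]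
    have "continuous_on S (\<beta> (Suc i))" for S
      by (rule continuous_at_imp_continuous_on) (blast intro: DERIV_isCont step(1))
    then show ?thesis using step(2-) by blast
  qed
  have "(\<forall>S. continuous_on S (\<alpha> i)) \<and> (\<forall>t. \<alpha> i (t + pi) = - \<alpha> i t) \<and>
   (\<forall>t. M i (t + pi) = M i t) \<and> (\<forall>t. (M i has_vector_derivative (\<alpha> i t * w t) *\<^sub>R v t) (at t))"
  proof (induction i)
    case 0
    then show ?case using \<alpha>_0 M_0 by blast
  next
    case (Suc i)
    note NS = N_step[OF Suc.IH]
    \<comment> \<open>The step from \<open>N\<close> to \<open>M\<close> is the same construction in
      the dual frame, with \<open>u\<close> in the role of \<open>v\<close> and
      \<open>- \<beta>\<close> as coefficient.\<close>
    interpret d: frame "\<lambda>t. - v t" u q w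
      by (rule dual)
    have "continuous_on S (\<lambda>t. - \<beta> (Suc i) t)" "- \<beta> (Suc i) (t + pi) = - (- \<beta> (Suc i) t)"
      "N (Suc i) (t + pi) = N (Suc i) t"
      "(N (Suc i) has_vector_derivative (- \<beta> (Suc i) t * q t) *\<^sub>R u t) (at t)" for S t
      using NS by (auto intro!: continuous_intros)
    note step = d.involute_step[OF this, of "\<alpha> (Suc i)" "M (Suc i)"]
    have "\<alpha> (Suc i) t = (1/2) * integral {t..t + pi} (\<lambda>s. - \<beta> (Suc i) s * q s)" for t
      by (simp add: \<alpha>_Suc)
    note step = step[OF this M_Suc]
    have "continuous_on S (\<alpha> (Suc i))" for S
      by (rule continuous_at_imp_continuous_on) (blast intro: DERIV_isCont step(1))
    then show ?case
      using step(2-) by simp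
  qed
  with N_step[OF this] show ?thesis by blast
qed

lemma M_per: "M i (t + pi) = M i t"
  and M_deriv: "(M i has_vector_derivative (\<alpha> i t * w t) *\<^sub>R v t) (at t)"
  and N_per: "N (Suc i) (t + pi) = N (Suc i) t"
  and N_deriv: "(N (Suc i) has_vector_derivative - (\<beta> (Suc i) t * q t) *\<^sub>R u t) (at t)"
  using invariants[of i] by blast+

end

text \<open>The condition \<open>balanced\<close> determines the central point, and it is inherited by all iterates.\<close>
locale balanced_involutes = iterated_involutes +
  fixes P :: "real^2"
  assumes balanced: "integral {0..pi} (\<lambda>t. (w t * bracket (P - M 0 t) (v t)) *\<^sub>R v t) = 0"
begin

definition X :: "nat \<Rightarrow> real \<Rightarrow> real" where "X i t = bracket (P - M i t) (v t)"
definition Y :: "nat \<Rightarrow> real \<Rightarrow> real" where "Y i t = bracket (u t) (P - M i t)"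

text \<open>\<open>M i\<close> and \<open>N (Suc i)\<close> differ by a multiple of
  \<open>v\<close>, which the bracket with \<open>v\<close> does not see. Likewise \<open>Y\<close>
  does not see the multiple of \<open>u\<close> between \<open>N (Suc i)\<close> and
  \<open>M (Suc i)\<close>. Each coordinate can thus be differentiated along the more convenient
  curve.\<close>

lemma X_N: "X i t = bracket (P - N (Suc i) t) (v t)"
  by (simp add: X_def N_Suc bracket.diff_left bracket.add_left bracket.scaleR_left)

lemma Y_N: "Y (Suc i) t = bracket (u t) (P - N (Suc i) t)"
  by (simp add: Y_def M_Suc bracket.diff_right bracket.add_right bracket.scaleR_right)

lemma M_eq: "M i t = P - (X i t *\<^sub>R u t + Y i t *\<^sub>R v t)"
  using bracket_basis_expansion[OF bracket_uv[of t], of "P - M i t"] by (simp add: X_def Y_def)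

lemma N_eq: "N (Suc i) t = P - (X i t *\<^sub>R u t + Y (Suc i) t *\<^sub>R v t)"
  using bracket_basis_expansion[OF bracket_uv[of t], of "P - N (Suc i) t"] by (simp add: X_N Y_N)

sublocale frame_iteration u v w q X Y
proof
  show "(X i has_real_derivative q t * Y i t) (at t)" for i t
  proof -
    have "((\<lambda>t. P - M i t) has_vector_derivative 0 - (\<alpha> i t * w t) *\<^sub>R v t) (at t)"
      by (intro has_vector_derivative_diff has_vector_derivative_const M_deriv)
    from has_real_derivative_bracket[OF this v_deriv] show ?thesis
      unfolding X_def[abs_def] Y_def bracket_commute[of "u t"]
      by (simp add: bracket.minus_left bracket.minus_right bracket.scaleR_left bracket.scaleR_right)
  qed
  show "(Y (Suc i) has_real_derivative - w t * X i t) (at t)" for i t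
  proof -
    have "((\<lambda>t. P - N (Suc i) t) has_vector_derivative 0 - (- (\<beta> (Suc i) t * q t) *\<^sub>R u t)) (at t)"
      by (intro has_vector_derivative_diff has_vector_derivative_const N_deriv)
    from has_real_derivative_bracket[OF u_deriv this] show ?thesis
      unfolding Y_N[abs_def] X_N
      by (simp add: bracket_commute[of "v t"] bracket.minus_right bracket.scaleR_left bracket.scaleR_right)
  qed
  show "X i (t + pi) = - X i t" "Y i (t + pi) = - Y i t" for i t
    by (simp_all add: X_def Y_def M_per bracket.minus_left bracket.minus_right)
  show "integral {0..pi} (\<lambda>t. (w t * X 0 t) *\<^sub>R v t) = 0"
    using balanced by (simp add: X_def)
qed

lemma P_in_region_M: "P \<in> region (M i)"
  using not_outside_if_orthogonal[OF M_per M_deriv, of P i] X_orth[of i]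
  by (simp add: region_def X_def)

lemma P_in_region_N: "P \<in> region (N (Suc i))"
proof -
  interpret d: frame "\<lambda>t. - v t" u q w
    by (rule dual)
  have "integral {0..pi} (\<lambda>t. (q t * bracket (P - N (Suc i) t) (u t)) *\<^sub>R u t)
      = - integral {0..pi} (\<lambda>t. (q t * Y (Suc i) t) *\<^sub>R u t)"
    unfolding Y_N bracket_commute[of _ "u _"] by simp
  then show ?thesis
    using d.not_outside_if_orthogonal[OF N_per N_deriv, of P i] Y_orth[of i]
    by (simp add: region_def)
qed

lemma region_subset_cball:
  assumes "\<And>t. dist P (K t) \<le> e"
  shows "region K \<subseteq> cball P e"
proof -
  have "range K \<subseteq> cball P e"
    using assms by auto
  from outside_subset_convex[OF convex_cball this] show ?thesis
    unfolding region_def by blast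
qed

text \<open>The curves \<open>M i\<close> shrink uniformly to \<open>P\<close>, so their regions
  alone already exclude every other point.\<close>

lemma inter_regions:
  assumes u: "unif_bdd (\<lambda>_. u)" and v: "unif_bdd (\<lambda>_. v)"
  shows "(\<Inter>i. region (M i)) \<inter> (\<Inter>i\<in>{1..}. region (N i)) = {P}"
proof -
  have "P \<in> region (N i)" if "i \<ge> 1" for i
    using P_in_region_N[of "i - 1"] that by simp
  moreover have "Q = P" if Q: "\<And>i. Q \<in> region (M i)" for Q
  proof (rule ccontr)
    assume "Q \<noteq> P"
    have "unif_null (\<lambda>i t. X i t *\<^sub>R u t + Y i t *\<^sub>R v t)"
      using bounded_bilinear.unif_null_prod[OF bounded_bilinear.flip[OF bounded_bilinear_scaleR]]
        u v uniform_limit_X uniform_limit_Y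
      by (intro unif_null_add) (auto simp: unif_null_def)
    moreover have "dist P Q / 2 > 0"
      using \<open>Q \<noteq> P\<close> by simp
    ultimately have "\<forall>\<^sub>F i in sequentially. \<forall>t\<in>UNIV. dist (X i t *\<^sub>R u t + Y i t *\<^sub>R v t) 0 < dist P Q / 2"
      unfolding unif_null_def uniform_limit_iff by blast
    then obtain i where "\<And>t. norm (X i t *\<^sub>R u t + Y i t *\<^sub>R v t) < dist P Q / 2"
      using eventually_happens'[OF sequentially_bot] by fastforce
    then have "dist P (M i t) \<le> dist P Q / 2" for t
      by (simp add: M_eq dist_norm less_imp_le)
    from region_subset_cball[of "M i", OF this] Q[of i] have "dist P Q \<le> dist P Q / 2"
      by auto
    then show False using \<open>Q \<noteq> P\<close> by simp
  qed
  ultimately show ?thesis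
    using P_in_region_M by auto
qed

text \<open>Each differential equation trades a derivative of one family for a lower one of the
  other, times a fixed smooth factor. The member \<open>Y 0\<close>, outside the recursion, is
  covered by its own smoothness.\<close>

lemma derivs_in_null_XY:
  assumes smooth: "smoothb w" "smoothb q" "smoothb (Y 0)"
  shows "derivs_in unif_null n X \<and> derivs_in unif_null n Y"
proof (induction n)
  case 0
  then show ?case using uniform_limit_X uniform_limit_Y by (simp add: unif_null_def)
next
  case (Suc n)
  have "derivs_in unif_null n (\<lambda>i t. q t * Y i t)"
    using Suc.IH smooth by (intro bounded_bilinear.derivs_in_null_prod[OF bounded_bilinear_mult])
      (auto simp: smoothb_def)
  then have X: "derivs_in unif_null (Suc n) X"
    using X_deriv uniform_limit_X
    by (auto simp: unif_null_def has_real_derivative_iff_has_vector_derivative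
        intro!: exI[of _ "\<lambda>i t. q t * Y i t"])
  have "derivs_in unif_null n (\<lambda>i t. - w t * X i t)"
    using Suc.IH smoothb_minus[OF smooth(1)]
    by (intro bounded_bilinear.derivs_in_null_prod[OF bounded_bilinear_mult]) (auto simp: smoothb_def)
  then have "derivs_in unif_null (Suc n) (\<lambda>i. Y (Suc i))"
    using Y_deriv uniform_limit_Y unif_null_Suc_iff[of Y]
    by (auto simp: unif_null_def has_real_derivative_iff_has_vector_derivative
        intro!: exI[of _ "\<lambda>i t. - w t * X i t"])
  moreover have "derivs_in unif_bdd (Suc n) (\<lambda>_. Y 0)"
    using smooth(3) unfolding smoothb_def by blast
  ultimately have "derivs_in unif_null (Suc n) Y"
    by (rule derivs_in_null_if_Suc[rotated])
  with X show ?case by blast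
qed

lemma converges:
  assumes smooth: "smoothb u" "smoothb v" "smoothb w" "smoothb q" "smoothb (M 0)"
  shows "converges_Cinf (\<lambda>i t. M i t + c *\<^sub>R u t) (\<lambda>t. P + c *\<^sub>R u t)"
    and "converges_Cinf (\<lambda>i t. N (Suc i) t + d *\<^sub>R v t) (\<lambda>t. P + d *\<^sub>R v t)"
proof -
  have "smoothb (Y 0)"
    unfolding Y_def[abs_def]
    by (intro bracket.smoothb_prod smoothb_diff smoothb_const smooth)
  note XY = derivs_in_null_XY[OF smooth(3,4) this]
  note prod = bounded_bilinear.derivs_in_null_prod[OF bounded_bilinear.flip[OF bounded_bilinear_scaleR]]
  have uv: "derivs_in unif_bdd n (\<lambda>_ t. - u t)" "derivs_in unif_bdd n (\<lambda>_ t. - v t)" for n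
    using smoothb_minus[OF smooth(1)] smoothb_minus[OF smooth(2)] by (simp_all add: smoothb_def)
  have Xu: "derivs_in unif_null n (\<lambda>i t. X i t *\<^sub>R - u t)"
    and Yv: "derivs_in unif_null n (\<lambda>i t. Y i t *\<^sub>R - v t)"
    and Yv': "derivs_in unif_null n (\<lambda>i t. Y (Suc i) t *\<^sub>R - v t)" for n
    using prod[OF uv(1)] prod[OF uv(2)] XY derivs_in_null_Suc by blast+
  show "converges_Cinf (\<lambda>i t. M i t + c *\<^sub>R u t) (\<lambda>t. P + c *\<^sub>R u t)"
  proof (rule converges_CinfI)
    show "derivs_in unif_null n (\<lambda>i t. X i t *\<^sub>R - u t + Y i t *\<^sub>R - v t)" for n
      by (rule derivs_in_add[OF unif_null_add Xu Yv])
    show "smoothb (\<lambda>t. P + c *\<^sub>R u t)"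
      by (intro smoothb_add smoothb_scaleR smoothb_const smooth)
  qed (simp add: M_eq)
  show "converges_Cinf (\<lambda>i t. N (Suc i) t + d *\<^sub>R v t) (\<lambda>t. P + d *\<^sub>R v t)"
  proof (rule converges_CinfI)
    show "derivs_in unif_null n (\<lambda>i t. X i t *\<^sub>R - u t + Y (Suc i) t *\<^sub>R - v t)" for n
      by (rule derivs_in_add[OF unif_null_add Xu Yv'])
    show "smoothb (\<lambda>t. P + d *\<^sub>R v t)"
      by (intro smoothb_add smoothb_scaleR smoothb_const smooth)
  qed (simp add: N_eq)
qed

end

text \<open>The condition is an inhomogeneous linear equation with left-hand side
  \<open>L P\<close>. Here \<open>[P, L P]\<close> is the integral of
  \<open>w [P, v]\<^sup>2\<close>, which vanishes only for \<open>P = 0\<close> because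
  \<open>v\<close> takes two independent values; so \<open>L\<close> is injective and hence
  surjective.\<close>

lemma (in frame) balanced_point_exists:
  assumes M: "\<And>S. continuous_on S M"
  shows "\<exists>P. integral {0..pi} (\<lambda>t. (w t * bracket (P - M t) (v t)) *\<^sub>R v t) = 0"
proof -
  define L where "L = (\<lambda>P. integral {0..pi} (\<lambda>t. (w t * bracket P (v t)) *\<^sub>R v t))"
  have int: "(\<lambda>t. (w t * bracket (f t) (v t)) *\<^sub>R v t) integrable_on {0..pi}"
    if "\<And>S. continuous_on S f" for f
    by (intro integrable_continuous_real continuous_intros bracket.continuous_on that)
  have add: "integral {0..pi} (\<lambda>t. (w t * bracket (f t + g t) (v t)) *\<^sub>R v t) =
     integral {0..pi} (\<lambda>t. (w t * bracket (f t) (v t)) *\<^sub>R v t) +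
     integral {0..pi} (\<lambda>t. (w t * bracket (g t) (v t)) *\<^sub>R v t)"
    if "\<And>S. continuous_on S f" "\<And>S. continuous_on S g" for f g
    using integral_add[OF int[OF that(1)] int[OF that(2)]]
    by (simp add: bracket.add_left distrib_left scaleR_add_left)
  have "linear L"
  proof
    show "L (a + b) = L a + L b" for a b
      unfolding L_def by (rule add) auto
    show "L (r *\<^sub>R b) = r *\<^sub>R L b" for r b
      unfolding L_def by (simp add: bracket.scaleR_left mult.left_commute flip: integral_cmul)
  qed
  moreover have "inj L"
    unfolding linear_injective_0[OF \<open>linear L\<close>]
  proof (intro allI impI)
    fix P assume "L P = 0"
    let ?f = "\<lambda>t. w t * (bracket P (v t))\<^sup>2"
    have "bracket P (L P) = integral {0..pi} (bracket P \<circ> (\<lambda>t. (w t * bracket P (v t)) *\<^sub>R v t))"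
      unfolding L_def by (rule integral_linear[symmetric]) (auto intro: int bracket.bounded_linear_right)
    then have "integral {0..pi} ?f = 0"
      using \<open>L P = 0\<close>
      by (simp add: o_def bracket.scaleR_right bracket.zero_right power2_eq_square mult.assoc)
    moreover have "continuous_on {0..pi} ?f"
      by (intro continuous_intros bracket.continuous_on)
    ultimately have "\<forall>t\<in>{0..pi}. ?f t = 0"
      using integral_eq_0_iff[of 0 pi ?f] w_pos pi_gt_zero by (simp add: less_imp_le del: pi_gt_zero)
    then have zero: "bracket P (v t) = 0" if "t \<in> {0..pi}" for t
      using that w_pos[of t] by fastforce
    define c where "c = bracket (u 0) P"
    have P: "P = c *\<^sub>R v 0"
      using bracket_basis_expansion[OF bracket_uv[of 0], of P] zero[of 0] by (simp add: c_def)
    have "bracket (v 0) (v (pi / 2)) \<noteq> 0"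
      by (rule bracket_v_v_nonzero) auto
    then have "c = 0"
      using zero[of "pi / 2"] unfolding P by (simp add: bracket.scaleR_left)
    then show "P = 0"
      by (simp add: P)
  qed
  ultimately have "surj L"
    by (rule linear_injective_imp_surjective) simp
  then obtain P where P: "L P = integral {0..pi} (\<lambda>t. (w t * bracket (M t) (v t)) *\<^sub>R v t)"
    by (metis surjD)
  have "L P = integral {0..pi} (\<lambda>t. (w t * bracket ((P - M t) + M t) (v t)) *\<^sub>R v t)"
    by (simp add: L_def)
  also have "\<dots> = integral {0..pi} (\<lambda>t. (w t * bracket (P - M t) (v t)) *\<^sub>R v t) + L P"
    unfolding P by (rule add) (auto intro!: continuous_intros M)
  finally show ?thesis by auto
qed

section \<open>The central point of a convex curve\<close>

lemma edir_eq_unit_dir: "edir t = unit_dir (t + pi / 2)"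
  by (simp add: edir_def unit_dir_def cos_add sin_add)

lemma bracket_edir: "bracket (edir s) (edir t) = sin (t - s)"
  by (simp add: edir_eq_unit_dir bracket_unit_dir)

lemma edir_add_pi [simp]: "edir (t + pi) = - edir t"
  by (simp add: edir_def vec_eq_iff forall_2)

lemma has_vector_derivative_edir: "(edir has_vector_derivative edir (t + pi / 2)) (at t)"
proof -
  have edir: "edir = (\<lambda>x. - sin x *\<^sub>R vector [1, 0] + cos x *\<^sub>R vector [0, 1])"
    by (auto simp: edir_def vec_eq_iff forall_2)
  have "(edir has_vector_derivative
      (- sin t *\<^sub>R 0 + - cos t *\<^sub>R vector [1, 0]) + (cos t *\<^sub>R 0 + - sin t *\<^sub>R vector [0, 1])) (at t)"
    unfolding edir
    by (intro has_vector_derivative_add has_vector_derivative_scaleR has_vector_derivative_const)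
       (auto intro!: derivative_eq_intros)
  also have "(- sin t *\<^sub>R 0 + - cos t *\<^sub>R vector [1, 0]) + (cos t *\<^sub>R 0 + - sin t *\<^sub>R vector [0, 1])
      = edir (t + pi / 2)"
    by (simp add: edir_def vec_eq_iff forall_2 cos_add sin_add)
  finally show ?thesis .
qed

locale closed_convex_curve =
  fixes \<gamma> :: "real \<Rightarrow> real^2" and k :: real
  assumes smooth: "smooth_curve \<gamma>"
    and closed: "\<And>\<theta>. \<gamma> (\<theta> + 2 * pi) = \<gamma> \<theta>"
    and tangent: "\<And>\<theta>. \<exists>r>0. D \<gamma> \<theta> = r *\<^sub>R edir \<theta>"
    and k_pos: "k > 0"
begin

abbreviation "u \<equiv> ucurve \<gamma> k"
abbreviation "v \<equiv> vcurve \<gamma> k"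

definition w :: "real \<Rightarrow> real" where "w t = bracket (u t) (D u t)"
definition q :: "real \<Rightarrow> real" where "q t = bracket (v t) (D v t)"

lemma smoothb_\<gamma>: "smoothb \<gamma>"
  by (rule smoothb_if_smooth_curve[OF smooth closed]) simp

lemma \<gamma>_deriv: "(\<gamma> has_vector_derivative D \<gamma> t) (at t)"
  by (rule smoothb_D[OF smoothb_\<gamma>])

lemma smoothb_u: "smoothb u"
  unfolding ucurve_def[abs_def]
  by (intro smoothb_scaleR smoothb_const smoothb_diff smoothb_shift smoothb_\<gamma>)

lemma smoothb_M: "smoothb (area_evolute \<gamma>)"
  unfolding area_evolute_def[abs_def]
  by (intro smoothb_scaleR smoothb_const smoothb_add smoothb_shift smoothb_\<gamma>)

lemma D_u: "D u t = (k/2) *\<^sub>R (D \<gamma> t - D \<gamma> (t + pi))"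
  unfolding D_def[of u] unfolding ucurve_def[abs_def]
  by (intro vector_derivative_at bounded_linear.has_vector_derivative[OF bounded_linear_scaleR_right]
        has_vector_derivative_diff has_vector_derivative_shift \<gamma>_deriv)

lemma D_M: "D (area_evolute \<gamma>) t = (1/2) *\<^sub>R (D \<gamma> t + D \<gamma> (t + pi))"
  unfolding D_def[of "area_evolute \<gamma>"] unfolding area_evolute_def[abs_def]
  by (intro vector_derivative_at bounded_linear.has_vector_derivative[OF bounded_linear_scaleR_right]
        has_vector_derivative_add has_vector_derivative_shift \<gamma>_deriv)

lemma \<gamma>_add_pi_pi: "\<gamma> (t + pi + pi) = \<gamma> t"
  using closed[of t] by (simp add: algebra_simps)

lemma u_anti: "u (t + pi) = - u t"
  unfolding ucurve_def \<gamma>_add_pi_pi by (simp add: algebra_simps)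

lemma M_per: "area_evolute \<gamma> (t + pi) = area_evolute \<gamma> t"
  unfolding area_evolute_def \<gamma>_add_pi_pi by (simp add: add.commute)

lemma D_u_anti: "D u (t + pi) = - D u t"
  using D_periodic[of u pi "-1" t] u_anti smoothb_D(1)[OF smoothb_u]
  by (auto intro: differentiableI_vector)

lemma D_M_per: "D (area_evolute \<gamma>) (t + pi) = D (area_evolute \<gamma>) t"
  using D_periodic[of "area_evolute \<gamma>" pi 1 t] M_per smoothb_D(1)[OF smoothb_M]
  by (auto intro: differentiableI_vector)

text \<open>Points half a turn apart have opposite tangent directions, so the speeds
  \<open>r t\<close> and \<open>r (t + pi)\<close> add in the derivative of \<open>u\<close> and
  subtract in that of the area evolute.\<close>

lemma D_u_edir: "\<exists>p a. (\<forall>t. p t > 0 \<and> D u t = p t *\<^sub>R edir t \<and> D (area_evolute \<gamma>) t = a t *\<^sub>R D u t)"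
proof -
  obtain r where r: "\<And>t. r t > 0" "\<And>t. D \<gamma> t = r t *\<^sub>R edir t"
    using tangent by metis
  define p where "p t = k / 2 * (r t + r (t + pi))" for t
  define a where "a t = (r t - r (t + pi)) / (2 * p t)" for t
  have p: "p t > 0" for t
    using r(1)[of t] r(1)[of "t + pi"] k_pos by (simp add: p_def)
  have "D u t = p t *\<^sub>R edir t" for t
    unfolding D_u r(2) by (simp add: p_def scaleR_add_left scaleR_add_right distrib_left)
  moreover have "D (area_evolute \<gamma>) t = a t *\<^sub>R (p t *\<^sub>R edir t)" for t
  proof -
    have "a t * p t = (r t - r (t + pi)) / 2"
      using p[of t] by (simp add: a_def)
    then show ?thesis
      unfolding D_M r(2) by (simp add: scaleR_diff_left scaleR_diff_right diff_divide_distrib)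
  qed
  ultimately show ?thesis
    using p by metis
qed

text \<open>For fixed \<open>t\<close>, the component \<open>[u s, edir t]\<close> strictly
  decreases as \<open>s\<close> runs from \<open>t\<close> to \<open>t + pi\<close> and ends at the
  negative of its initial value, which is therefore positive.\<close>

lemma w_pos: "w t > 0"
proof -
  obtain p where p: "\<And>t. p t > 0" "\<And>t. D u t = p t *\<^sub>R edir t"
    using D_u_edir by metis
  define h where "h s = bracket (u s) (edir t)" for s
  have h: "(h has_real_derivative p s * sin (t - s)) (at s)" for s
    using has_real_derivative_bracket[OF smoothb_D(1)[OF smoothb_u, of s] has_vector_derivative_const[of "edir t"]]
    unfolding h_def by (simp add: p(2) bracket.scaleR_left bracket.zero_right bracket_edir)
  have "h (t + pi) < h t"
  proof (rule DERIV_neg_imp_decreasing_open[of t "t + pi" h])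
    show "\<exists>y. (h has_real_derivative y) (at s) \<and> y < 0" if "t < s" "s < t + pi" for s
    proof (intro exI conjI)
      have "sin (s - t) > 0"
        using that by (intro sin_gt_zero) auto
      then show "p s * sin (t - s) < 0"
        using p(1)[of s] sin_minus[of "s - t"] by (simp add: mult_less_0_iff)
    qed (rule h)
    show "continuous_on {t..t + pi} h"
      by (rule continuous_at_imp_continuous_on) (blast intro: DERIV_isCont h)
  qed simp
  then have "h t > 0"
    by (simp add: h_def u_anti bracket.minus_left)
  then show ?thesis
    using p(1)[of t] by (simp add: w_def p(2) bracket.scaleR_right h_def)
qed

lemma w_per: "w (t + pi) = w t"
  by (simp add: w_def u_anti D_u_anti bracket.minus_left bracket.minus_right)

lemma smoothb_w: "smoothb w"
  unfolding w_def[abs_def] by (intro bracket.smoothb_prod smoothb_u smoothb_D(2))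

lemma v_eq: "v t = inverse (w t) *\<^sub>R D u t"
  by (simp add: vcurve_def w_def inverse_eq_divide)

lemma smoothb_v: "smoothb v"
proof -
  have "continuous_on UNIV (\<lambda>t. inverse (w t))"
    by (intro continuous_on_inverse smoothb_continuous smoothb_w) (use w_pos in \<open>auto simp: less_le\<close>)
  then obtain B where B: "\<And>t. norm (inverse (w t)) \<le> B"
    using periodic_bounded[of "\<lambda>t. inverse (w t)" pi] w_per by auto
  \<comment> \<open>The upper bound on \<open>1/w\<close> is a positive lower bound on
    \<open>w\<close>, as needed to invert \<open>w\<close> smoothly.\<close>
  have "inverse B > 0" "w t \<ge> inverse B" for t
    using B[of t] w_pos[of t] le_imp_inverse_le[of "inverse (w t)" B] less_le_trans[of 0 "inverse (w t)" B]
    by auto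
  then have "smoothb (\<lambda>t. inverse (w t))"
    using smoothb_inverse[OF smoothb_w] by blast
  then have "smoothb (\<lambda>t. inverse (w t) *\<^sub>R D u t)"
    by (intro smoothb_scaleR smoothb_D(2) smoothb_u)
  then show ?thesis
    by (simp add: v_eq[abs_def])
qed

lemma smoothb_q: "smoothb q"
  unfolding q_def[abs_def] by (intro bracket.smoothb_prod smoothb_v smoothb_D(2))

lemma bracket_uv: "bracket (u t) (v t) = 1"
  using w_pos[of t] by (simp add: v_eq bracket.scaleR_right flip: w_def)

lemma u_deriv: "(u has_vector_derivative w t *\<^sub>R v t) (at t)"
  using smoothb_D(1)[OF smoothb_u, of t] w_pos[of t] by (simp add: v_eq)

text \<open>Differentiating \<open>[u, v] = 1\<close> shows that \<open>v'\<close> has no component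
  along \<open>v\<close>; its component along \<open>u\<close> is
  \<open>[v', v] = - q\<close>.\<close>

lemma v_deriv: "(v has_vector_derivative - q t *\<^sub>R u t) (at t)"
proof -
  note v' = smoothb_D(1)[OF smoothb_v, of t]
  have "((\<lambda>t. bracket (u t) (v t)) has_real_derivative bracket (w t *\<^sub>R v t) (v t) + bracket (u t) (D v t)) (at t)"
    by (rule has_real_derivative_bracket[OF u_deriv v'])
  then have "bracket (u t) (D v t) = 0"
    unfolding bracket_uv bracket.scaleR_left using DERIV_unique[OF _ DERIV_const] by fastforce
  then have "D v t = - q t *\<^sub>R u t"
    using bracket_basis_expansion[OF bracket_uv, of "D v t" t] bracket_commute[of "D v t" "v t"]
    by (simp add: q_def)
  with v' show ?thesis by simp
qed

lemma v_edir: "\<exists>r. (\<forall>t. r t > 0 \<and> v t = r t *\<^sub>R edir t)"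
proof -
  obtain p where p: "\<And>t. p t > 0" "\<And>t. D u t = p t *\<^sub>R edir t"
    using D_u_edir by metis
  then show ?thesis
    using w_pos by (intro exI[of _ "\<lambda>t. inverse (w t) * p t"]) (simp add: v_eq)
qed

text \<open>Differentiating \<open>[edir, v] = 0\<close> gives \<open>[edir, v'] = r\<close>, hence
  \<open>q = r\<^sup>2\<close>.\<close>

lemma q_pos: "q t > 0"
proof -
  obtain r where r: "\<And>t. r t > 0" "\<And>t. v t = r t *\<^sub>R edir t"
    using v_edir by metis
  have "((\<lambda>t. bracket (edir t) (v t)) has_real_derivative
      bracket (edir (t + pi / 2)) (v t) + bracket (edir t) (D v t)) (at t)"
    by (rule has_real_derivative_bracket[OF has_vector_derivative_edir smoothb_D(1)[OF smoothb_v]])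
  moreover have "(\<lambda>t. bracket (edir t) (v t)) = (\<lambda>t. 0)"
    by (simp add: r(2) bracket.scaleR_right)
  ultimately have "bracket (edir (t + pi / 2)) (v t) + bracket (edir t) (D v t) = 0"
    using DERIV_unique[OF _ DERIV_const] by fastforce
  moreover have "bracket (edir (t + pi / 2)) (v t) = - r t"
    by (simp add: r(2) bracket.scaleR_right bracket_edir)
  ultimately show ?thesis
    using r(1)[of t] by (simp add: q_def r(2)[of t] bracket.scaleR_left)
qed

lemma v_anti: "v (t + pi) = - v t"
  by (simp add: v_eq w_per D_u_anti)

lemma q_per: "q (t + pi) = q t"
  using D_periodic[of v pi "-1" t] differentiableI_vector[OF smoothb_D(1)[OF smoothb_v]]
  by (simp add: q_def v_anti bracket.minus_left bracket.minus_right)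

sublocale frame u v w q
proof
  obtain r where r: "\<And>t. r t > 0" "\<And>t. v t = r t *\<^sub>R edir t"
    using v_edir by metis
  show "half_turn v"
    unfolding half_turn_def
    by (rule exI[of _ r], rule exI[of _ "\<lambda>t. t + pi / 2"])
       (auto simp: r edir_eq_unit_dir intro!: continuous_intros)
qed (rule u_deriv v_deriv bracket_uv w_pos q_pos u_anti v_anti w_per q_per
       smoothb_continuous smoothb_w smoothb_q)+

text \<open>The description operator in \<open>alpha\<close> is well defined because the derivative
  of \<open>u\<close> never vanishes.\<close>

lemma alpha_0: "D (area_evolute \<gamma>) t = alpha \<gamma> k 0 t *\<^sub>R D u t"
proof -
  obtain p a where p: "\<And>t. p t > 0" "\<And>t. D u t = p t *\<^sub>R edir t"
    and a: "\<And>t. D (area_evolute \<gamma>) t = a t *\<^sub>R D u t"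
    using D_u_edir by metis
  have nz: "D u t \<noteq> 0" for t
    using w_pos[of t] by (auto simp: w_def bracket.zero_right)
  have "\<forall>t. D (area_evolute \<gamma>) t = alpha \<gamma> k 0 t *\<^sub>R D u t"
    unfolding alpha.simps
  proof (rule theI[of _ a])
    show "b = a" if "\<forall>t. D (area_evolute \<gamma>) t = b t *\<^sub>R D u t" for b
    proof
      fix t
      have "b t *\<^sub>R D u t = a t *\<^sub>R D u t"
        using that a by metis
      then show "b t = a t" using nz by simp
    qed
  qed (use a in blast)
  then show ?thesis by blast
qed

lemma alpha_0_eq: "alpha \<gamma> k 0 t = bracket (u t) (D (area_evolute \<gamma>) t) / w t"
  using w_pos[of t] by (simp add: alpha_0 bracket.scaleR_right del: alpha.simps flip: w_def)

sublocale iterated_involutes u v w q "Mcurve \<gamma> k" "Ncurve \<gamma> k" "alpha \<gamma> k" "beta \<gamma> k"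
proof
  show "continuous_on S (alpha \<gamma> k 0)" for S
    unfolding alpha_0_eq[abs_def]
    by (intro continuous_intros bracket.continuous_on smoothb_continuous smoothb_D(2) smoothb_M smoothb_u smoothb_w)
       (use w_pos in \<open>auto simp: less_le\<close>)
  show "alpha \<gamma> k 0 (t + pi) = - alpha \<gamma> k 0 t" for t
    unfolding alpha_0_eq by (simp add: w_per D_M_per bracket.minus_left)
  show "(Mcurve \<gamma> k 0 has_vector_derivative (alpha \<gamma> k 0 t * w t) *\<^sub>R v t) (at t)" for t
    using smoothb_D(1)[OF smoothb_M, of t] w_pos[of t] by (simp add: alpha_0 v_eq mult.assoc del: alpha.simps)
qed (simp_all add: M_per w_def[abs_def] q_def[abs_def])

lemma converges_to_central_point:
  "converges_Cinf (\<lambda>i \<theta>. Mcurve \<gamma> k i \<theta> + c *\<^sub>R u \<theta>) (\<lambda>\<theta>. central_point \<gamma> k + c *\<^sub>R u \<theta>)"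
  "converges_Cinf (\<lambda>i \<theta>. Ncurve \<gamma> k (Suc i) \<theta> + d *\<^sub>R v \<theta>) (\<lambda>\<theta>. central_point \<gamma> k + d *\<^sub>R v \<theta>)"
proof -
  obtain P where P: "integral {0..pi} (\<lambda>t. (w t * bracket (P - Mcurve \<gamma> k 0 t) (v t)) *\<^sub>R v t) = 0"
    using balanced_point_exists[of "Mcurve \<gamma> k 0"] smoothb_continuous[OF smoothb_M] by auto
  interpret balanced_involutes u v w q "Mcurve \<gamma> k" "Ncurve \<gamma> k" "alpha \<gamma> k" "beta \<gamma> k" P
    by unfold_locales (rule P)
  \<comment> \<open>The balanced point is the only common point of all regions, so it is the central
    point.\<close>
  have O: "central_point \<gamma> k = P"
    unfolding central_point_def
    using smoothb_u smoothb_v by (subst inter_regions) (auto simp: smoothb_def dest: derivs_in_base)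
  have M_0: "smoothb (Mcurve \<gamma> k 0)"
    using smoothb_M by simp
  note converges = converges[OF smoothb_u smoothb_v smoothb_w smoothb_q M_0]
  show
    "converges_Cinf (\<lambda>i \<theta>. Mcurve \<gamma> k i \<theta> + c *\<^sub>R u \<theta>) (\<lambda>\<theta>. central_point \<gamma> k + c *\<^sub>R u \<theta>)"
    unfolding O by (rule converges(1))
  show
    "converges_Cinf (\<lambda>i \<theta>. Ncurve \<gamma> k (Suc i) \<theta> + d *\<^sub>R v \<theta>) (\<lambda>\<theta>. central_point \<gamma> k + d *\<^sub>R v \<theta>)"
    unfolding O by (rule converges(2))
qed

end

theorem theorem5p2:
  fixes \<gamma> :: "real \<Rightarrow> real^2" and k c d :: real
  assumes smooth: "smooth_curve \<gamma>"
    and closed: "\<And>\<theta>. \<gamma> (\<theta> + 2 * pi) = \<gamma> \<theta>"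
    and tangent: "\<And>\<theta>. \<exists>r>0. D \<gamma> \<theta> = r *\<^sub>R edir \<theta>"
    and curvature_pos: "\<And>\<theta>. curvature \<gamma> \<theta> > 0"
    and convex: "bounds_convex_region \<gamma>"
    and k_pos: "k > 0"
    and convex_M: "\<And>i. bounds_convex_region (\<lambda>\<theta>. Mcurve \<gamma> k i \<theta> + c *\<^sub>R ucurve \<gamma> k \<theta>)"
    and convex_N: "\<And>i. i \<ge> 1 \<Longrightarrow>
      bounds_convex_region (\<lambda>\<theta>. Ncurve \<gamma> k i \<theta> + d *\<^sub>R vcurve \<gamma> k \<theta>)"
  shows "converges_Cinf (\<lambda>i \<theta>. Mcurve \<gamma> k i \<theta> + c *\<^sub>R ucurve \<gamma> k \<theta>)
           (\<lambda>\<theta>. central_point \<gamma> k + c *\<^sub>R ucurve \<gamma> k \<theta>) \<and>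
         converges_Cinf (\<lambda>i \<theta>. Ncurve \<gamma> k (Suc i) \<theta> + d *\<^sub>R vcurve \<gamma> k \<theta>)
           (\<lambda>\<theta>. central_point \<gamma> k + d *\<^sub>R vcurve \<gamma> k \<theta>)"
proof -
  interpret closed_convex_curve \<gamma> k
    by unfold_locales (fact smooth closed tangent k_pos)+
  show ?thesis
    using converges_to_central_point by blast
qed

end
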